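(* Let $n\ge 4$ and let $f^{(n)}$ be a symmetric form of degree $4$ in $n$ variables. If $f^{(n)}$ is a sum of squares, then it can be written as $$f^{(n)}=\alpha_{11}p_{(1^4)}+2\alpha_{12}p_{(2,1^2)}+\alpha_{22}p_{(2^2)}+\beta_{11}\left(p_{(2,1^2)}-p_{(1^4)}\right)+2\beta_{12}\left(p_{(3,1)}-p_{(2,1^2)}\right)+\beta_{22}\left(p_{(4)}-p_{(2^2)}\right)$$ $$+\gamma\left(\tfrac12 p_{(1^4)}-p_{(2,1^2)}+\tfrac{n^2-3n+3}{2n^2}p_{(2^2)}+\tfrac{2n-2}{n^2}p_{(3,1)}+\tfrac{1-n}{2n^2}p_{(4)}\right)$$ with $\gamma\ge 0$ and the matrices $\begin{pmatrix}\alpha_{11}&\alpha_{12}\\ \alpha_{12}&\alpha_{22}\end{pmatrix}$ and $\begin{pmatrix}\beta_{11}&\beta_{12}\\ \beta_{12}&\beta_{22}\end{pmatrix}$ positive semidefinite.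
   Context: $p_i=\frac1n(x_1^i+\dots+x_n^i)$ and $p_\lambda=\prod_i p_{\lambda_i}$ for a partition $\lambda$; e.g. $p_{(2,1^2)}=p_2p_1^2$, $p_{(1^4)}=p_1^4$, $p_{(2^2)}=p_2^2$, $p_{(3,1)}=p_3p_1$, $p_{(4)}=p_4$. *)

theory Defs
  imports Complex_Main "HOL-Combinatorics.Permutations"
begin

text \<open>Polynomials in the n variables x 0, ..., x (n-1) over the reals, represented by
their polynomial functions (faithful, since the reals are infinite).
A point is a function nat => real; only coordinates below n are used.\<close>

definition monom :: "nat \<Rightarrow> (nat \<Rightarrow> nat) \<Rightarrow> (nat \<Rightarrow> real) \<Rightarrow> real" where
  "monom n a x = (\<Prod>i<n. x i ^ a i)"

definition poly_fun :: "nat \<Rightarrow> ((nat \<Rightarrow> real) \<Rightarrow> real) \<Rightarrow> bool" where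
  "poly_fun n p \<longleftrightarrow> (\<exists>S c. finite S \<and> (\<forall>a\<in>S. \<forall>i\<ge>n. a i = 0) \<and>
      (\<forall>x. p x = (\<Sum>a\<in>S. c a * monom n a x)))"

definition form_deg :: "nat \<Rightarrow> nat \<Rightarrow> ((nat \<Rightarrow> real) \<Rightarrow> real) \<Rightarrow> bool" where
  "form_deg n d p \<longleftrightarrow> (\<exists>S c. finite S \<and> (\<forall>a\<in>S. (\<forall>i\<ge>n. a i = 0) \<and> (\<Sum>i<n. a i) = d) \<and>
      (\<forall>x. p x = (\<Sum>a\<in>S. c a * monom n a x)))"

definition symmetric_poly :: "nat \<Rightarrow> ((nat \<Rightarrow> real) \<Rightarrow> real) \<Rightarrow> bool" where
  "symmetric_poly n p \<longleftrightarrow> (\<forall>\<sigma>. \<sigma> permutes {..<n} \<longrightarrow> (\<forall>x. p (x \<circ> \<sigma>) = p x))"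

definition sos :: "nat \<Rightarrow> ((nat \<Rightarrow> real) \<Rightarrow> real) \<Rightarrow> bool" where
  "sos n p \<longleftrightarrow> (\<exists>gs. (\<forall>g\<in>set gs. poly_fun n g) \<and> (\<forall>x. p x = (\<Sum>g\<leftarrow>gs. (g x)\<^sup>2)))"

definition psum :: "nat \<Rightarrow> nat \<Rightarrow> (nat \<Rightarrow> real) \<Rightarrow> real" where
  "psum n i x = (1 / real n) * (\<Sum>k<n. x k ^ i)"

definition psd2 :: "real \<Rightarrow> real \<Rightarrow> real \<Rightarrow> bool" where
  "psd2 a b c \<longleftrightarrow> (\<forall>u v. a * u\<^sup>2 + 2 * b * u * v + c * v\<^sup>2 \<ge> 0)"

end

theory Submission
  imports Defs "HOL-Computational_Algebra.Fundamental_Theorem_Algebra"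
begin

text \<open>Since \<open>f\<close> is homogeneous of degree 4, each square \<open>g\<^sup>2\<close> in a representation of \<open>f\<close> satisfies
  \<open>\<bar>g (t x)\<bar> \<le> C t\<^sup>2\<close>, so \<open>g\<close> is a quadratic form. As \<open>f\<close> is symmetric, it is the sum of the averages of
  the \<open>g\<^sup>2\<close> over all permutations of the variables, and the claimed forms make up a convex cone, so
  it is enough to treat one \<open>g\<close>. Write \<open>g = \<Sum> u\<^sub>i x\<^sub>i\<^sup>2 + p\<^sub>1 \<Sum> v\<^sub>i x\<^sub>i + \<Sum> B\<^sub>i\<^sub>j x\<^sub>i x\<^sub>j\<close> with \<open>B\<close> symmetric, of zero
  diagonal and zero row sums. In the average of \<open>g\<^sup>2\<close>, the sums of \<open>u\<close> and \<open>v\<close> produce \<open>\<alpha>\<close> (a matrix of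
  rank one), the Gram matrix of the centred vectors \<open>v\<close> and \<open>u\<close> produces \<open>\<beta>\<close>, and the squared norm of
  \<open>B\<close> produces \<open>\<gamma>\<close>; all mixed terms vanish.\<close>

section \<open>Squares in a quartic: reduction to quadratic forms\<close>

text \<open>Near 0 the bound forces a double zero, so \<open>t\<close> can be divided out twice; at
  infinity it forces the remaining quotient, which is bounded, to be constant.\<close>

lemma poly_le_square_imp_quadratic:
  fixes p :: "real poly"
  assumes bound: "\<And>t. \<bar>poly p t\<bar> \<le> C * t\<^sup>2"
  shows "p = [:0, 0, coeff p 2:]"
proof -
  obtain a p1 where p: "p = pCons a p1" by (cases p)
  have a: "a = 0" using bound[of 0] p by simp
  have p1_bound: "\<bar>poly p1 t\<bar> \<le> C * \<bar>t\<bar>" if "t \<noteq> 0" for t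
  proof -
    have "C * t\<^sup>2 = \<bar>t\<bar> * (C * \<bar>t\<bar>)" by (simp add: power2_eq_square)
    then have "\<bar>t\<bar> * \<bar>poly p1 t\<bar> \<le> \<bar>t\<bar> * (C * \<bar>t\<bar>)"
      using bound[of t] unfolding p a by (simp only: poly_pCons add_0_left abs_mult)
    then show ?thesis using that by simp
  qed
  obtain b q where p1: "p1 = pCons b q" by (cases p1)
  \<comment> \<open>The bound on \<open>p1\<close> is known only away from 0, so the value at 0 is
    reached by continuity.\<close>
  have "((\<lambda>t. poly p1 t) \<longlongrightarrow> 0) (at 0)"
  proof (rule tendsto_0_le[OF tendsto_ident_at])
    show "\<forall>\<^sub>F t in at 0. norm (poly p1 t) \<le> norm t * C"
      using p1_bound by (auto simp: eventually_at_filter mult.commute)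
  qed
  moreover have "((\<lambda>t. poly p1 t) \<longlongrightarrow> poly p1 0) (at 0)"
    by (rule tendsto_poly[OF tendsto_ident_at])
  ultimately have "poly p1 0 = 0" by (rule LIM_unique[symmetric])
  then have b: "b = 0" using p1 by simp
  have q_bound: "\<bar>poly q t\<bar> \<le> C" if "t \<noteq> 0" for t
  proof -
    have "\<bar>t\<bar> * \<bar>poly q t\<bar> \<le> \<bar>t\<bar> * C"
      using p1_bound[OF that] p1 b by (simp add: abs_mult mult_ac)
    then show ?thesis using that by simp
  qed
  obtain c r where q: "q = pCons c r" by (cases q)
  have r: "r = 0"
  proof (rule ccontr)
    assume "r \<noteq> 0"
    then obtain R where R: "\<forall>z. R \<le> norm z \<longrightarrow> C + 1 \<le> norm (poly (pCons c r) z)"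
      using poly_infinity[of r "C + 1" c] by blast
    \<comment> \<open>The point \<open>\<bar>R\<bar> + 1\<close> is both beyond the threshold
      \<open>R\<close> and non-zero, as \<open>q_bound\<close> demands.\<close>
    have "C + 1 \<le> \<bar>poly q (\<bar>R\<bar> + 1)\<bar>" using R[rule_format, of "\<bar>R\<bar> + 1"] q by simp
    moreover have "\<bar>R\<bar> + 1 \<noteq> 0" by linarith
    ultimately show False using q_bound[of "\<bar>R\<bar> + 1"] by linarith
  qed
  show ?thesis using p a p1 b q r by (simp add: numeral_2_eq_2)
qed

lemma monom_scale: "Defs.monom n a (\<lambda>i. t * x i) = t ^ (\<Sum>i<n. a i) * Defs.monom n a x"
  by (simp add: Defs.monom_def power_mult_distrib prod.distrib power_sum)

text \<open>Peels one variable off a monomial; two rounds turn a monomial of degree 2 into a product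
  of two variables.\<close>

lemma monom_reduce:
  assumes "i < n" "a i = Suc m"
  shows "Defs.monom n a x = x i * Defs.monom n (a(i := m)) x"
    and "(\<Sum>k<n. a k) = Suc (\<Sum>k<n. (a(i := m)) k)"
proof -
  have fin: "finite {..<n}" "i \<in> {..<n}" using assms by auto
  show "Defs.monom n a x = x i * Defs.monom n (a(i := m)) x"
    unfolding Defs.monom_def prod.remove[OF fin]
    using assms by (auto intro!: prod.cong)
  show "(\<Sum>k<n. a k) = Suc (\<Sum>k<n. (a(i := m)) k)"
    unfolding sum.remove[OF fin]
    using assms by (auto intro!: sum.cong)
qed

text \<open>\<open>A\<close> may be asymmetric, so that a single monomial corresponds to a single
  matrix entry; \<open>quad_form_symmetric_matrix\<close> symmetrises afterwards.\<close>

definition quad_form :: "nat \<Rightarrow> ((nat \<Rightarrow> real) \<Rightarrow> real) \<Rightarrow> bool" where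
  "quad_form n g \<longleftrightarrow> (\<exists>A. \<forall>x. g x = (\<Sum>i<n. \<Sum>j<n. A i j * (x i * x j)))"

lemma quad_form_add:
  assumes "quad_form n g" "quad_form n h"
  shows "quad_form n (\<lambda>x. g x + h x)"
proof -
  obtain A B where "\<And>x. g x = (\<Sum>i<n. \<Sum>j<n. A i j * (x i * x j))"
    "\<And>x. h x = (\<Sum>i<n. \<Sum>j<n. B i j * (x i * x j))"
    using assms by (auto simp: quad_form_def)
  then have "g x + h x = (\<Sum>i<n. \<Sum>j<n. (A i j + B i j) * (x i * x j))" for x
    by (simp add: distrib_right sum.distrib)
  then show ?thesis unfolding quad_form_def by (intro exI[of _ "\<lambda>i j. A i j + B i j"]) simp
qed

lemma quad_form_sum:
  assumes "finite S" "\<And>a. a \<in> S \<Longrightarrow> quad_form n (g a)"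
  shows "quad_form n (\<lambda>x. \<Sum>a\<in>S. g a x)"
  using assms
proof (induction S rule: finite_induct)
  case empty
  show ?case unfolding quad_form_def by (intro exI[of _ "\<lambda>i j. 0"]) simp
next
  case (insert a S)
  then show ?case by (simp add: quad_form_add)
qed

lemma quad_form_monom:
  assumes "(\<Sum>i<n. a i) = 2"
  shows "quad_form n (\<lambda>x. c * Defs.monom n a x)"
proof -
  have ex: "\<exists>i<n. \<exists>m. b i = Suc m" if "(\<Sum>i<n. b i) \<noteq> 0" for b :: "nat \<Rightarrow> nat"
    using that by (auto simp: not0_implies_Suc)
  obtain i m where i: "i < n" "a i = Suc m" using ex[of a] assms by auto
  let ?b = "a(i := m)"
  have b: "(\<Sum>k<n. ?b k) = 1" using monom_reduce(2)[of i n a m, OF i] assms by simp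
  obtain j m' where j: "j < n" "?b j = Suc m'" using ex[of ?b] unfolding b by auto
  \<comment> \<open>After two variables are split off the degree is 0, so the remaining monomial is
    1. The indices \<open>i\<close> and \<open>j\<close> may coincide.\<close>
  have "(\<Sum>k<n. (?b(j := m')) k) = 0" using monom_reduce(2)[of j n ?b m', OF j] b by linarith
  then have "Defs.monom n (?b(j := m')) x = 1" for x
    unfolding Defs.monom_def by (intro prod.neutral) auto
  then have eq: "Defs.monom n a x = x i * x j" for x
    using monom_reduce(1)[of i n a m, OF i, of x] monom_reduce(1)[of j n ?b m', OF j, of x] by simp
  \<comment> \<open>The matrix has one non-zero entry; nesting the conditionals lets the sums over
    \<open>l\<close> and \<open>k\<close> collapse one after the other.\<close>
  have "c * (x i * x j) = (\<Sum>k<n. \<Sum>l<n. (if k = i then if l = j then c else 0 else 0) * (x k * x l))" for x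
  proof -
    have "(\<Sum>l<n. (if k = i then if l = j then c else 0 else 0) * (x k * x l))
       = (if k = i then c * (x i * x j) else 0)" for k
      using j by (simp add: if_distrib[of "\<lambda>y. y * _"] cong: if_cong)
    then show ?thesis using i by simp
  qed
  then show ?thesis unfolding quad_form_def eq
    by (intro exI[of _ "\<lambda>k l. if k = i then if l = j then c else 0 else 0"]) blast
qed

lemma quad_form_symmetric_matrix:
  assumes "quad_form n g"
  obtains A where "\<And>i j. A i j = A j i" "\<And>x. g x = (\<Sum>i<n. \<Sum>j<n. A i j * (x i * x j))"
proof -
  obtain A where A: "\<And>x. g x = (\<Sum>i<n. \<Sum>j<n. A i j * (x i * x j))"
    using assms by (auto simp: quad_form_def)
  have "g x = (\<Sum>i<n. \<Sum>j<n. (A i j + A j i) / 2 * (x i * x j))" for x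
  proof -
    have "g x = (\<Sum>i<n. \<Sum>j<n. A j i * (x i * x j))"
      unfolding A by (subst sum.swap) (simp add: mult_ac)
    then have "2 * g x = (\<Sum>i<n. \<Sum>j<n. (A i j + A j i) * (x i * x j))"
      using A[of x] by (simp add: distrib_right sum.distrib)
    then show ?thesis by (simp flip: sum_divide_distrib)
  qed
  then show thesis by (intro that[of "\<lambda>i j. (A i j + A j i) / 2"]) (simp_all add: add_ac)
qed

text \<open>On each ray through the origin the bound kills every homogeneous component except the
  one of degree 2. The constant may depend on the ray, since the rays are treated
  separately.\<close>

lemma poly_fun_quadratic_bound_imp_quad_form:
  assumes g: "poly_fun n g"
    and bound: "\<And>t x. \<bar>g (\<lambda>i. t * x i)\<bar> \<le> C x * t\<^sup>2"
  shows "quad_form n g"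
proof -
  obtain S c where S: "finite S" and gS: "\<And>x. g x = (\<Sum>a\<in>S. c a * Defs.monom n a x)"
    using g unfolding poly_fun_def by blast
  have "g x = (\<Sum>a\<in>{a\<in>S. (\<Sum>i<n. a i) = 2}. c a * Defs.monom n a x)" for x
  proof -
    \<comment> \<open>The restriction of \<open>g\<close> to the ray through \<open>x\<close>, as a
      polynomial in \<open>t\<close>: its coefficients are the values at \<open>x\<close> of the
      homogeneous components of \<open>g\<close>.\<close>
    define p where "p = (\<Sum>a\<in>S. Polynomial.monom (c a * Defs.monom n a x) (\<Sum>i<n. a i))"
    have p: "poly p t = g (\<lambda>i. t * x i)" for t
      by (simp add: p_def gS monom_scale poly_sum poly_monom mult_ac)
    have "p = [:0, 0, coeff p 2:]"
      using bound by (intro poly_le_square_imp_quadratic[of p "C x"]) (simp add: p)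
    then have "poly p 1 = poly [:0, 0, coeff p 2:] 1" by (rule arg_cong)
    then have "poly p 1 = coeff p 2" by simp
    then have "g x = coeff p 2" by (simp add: p)
    also have "\<dots> = (\<Sum>a\<in>S. if (\<Sum>i<n. a i) = 2 then c a * Defs.monom n a x else 0)"
      by (simp add: p_def coeff_sum)
    finally show ?thesis using S by (simp add: sum.inter_filter)
  qed
  then have "g = (\<lambda>x. \<Sum>a\<in>{a\<in>S. (\<Sum>i<n. a i) = 2}. c a * Defs.monom n a x)" by blast
  moreover have "quad_form n \<dots>" using S by (intro quad_form_sum quad_form_monom) auto
  ultimately show ?thesis by simp
qed

lemma form_deg_scale:
  assumes "form_deg n d f"
  shows "f (\<lambda>i. t * x i) = t ^ d * f x"
proof -
  obtain S c where "\<forall>a\<in>S. (\<Sum>i<n. a i) = d" and f: "\<And>x. f x = (\<Sum>a\<in>S. c a * Defs.monom n a x)"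
    using assms unfolding form_deg_def by blast
  then show ?thesis
    unfolding f sum_distrib_left monom_scale by (intro sum.cong) auto
qed

text \<open>A single square is at most the whole sum \<open>f\<close>, which grows like
  \<open>t ^ 4\<close> along a ray; taking roots bounds \<open>g\<close> by
  \<open>sqrt (f x)\<close> times the square of \<open>t\<close>.\<close>

lemma sos_quartic_quad_forms:
  assumes f: "form_deg n 4 f" and eq: "\<And>x. f x = (\<Sum>g\<leftarrow>gs. (g x)\<^sup>2)"
    and g: "g \<in> set gs" "poly_fun n g"
  shows "quad_form n g"
proof (rule poly_fun_quadratic_bound_imp_quad_form[OF g(2)])
  fix t x
  have nonneg: "0 \<le> f y" for y unfolding eq by (intro sum_list_nonneg) auto
  have "(g (\<lambda>i. t * x i))\<^sup>2 \<le> f (\<lambda>i. t * x i)"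
    unfolding eq using g(1) by (intro member_le_sum_list) auto
  also have "\<dots> = (sqrt (f x) * t\<^sup>2)\<^sup>2"
    using form_deg_scale[OF f, of t x] nonneg[of x] by (simp add: power_mult_distrib flip: power_mult)
  finally have "\<bar>g (\<lambda>i. t * x i)\<bar> \<le> \<bar>sqrt (f x) * t\<^sup>2\<bar>" by (simp add: abs_le_square_iff)
  also have "\<dots> = sqrt (f x) * t\<^sup>2" using nonneg[of x] by simp
  finally show "\<bar>g (\<lambda>i. t * x i)\<bar> \<le> sqrt (f x) * t\<^sup>2" .
qed

section \<open>Averages over the symmetric group\<close>

definition perm_avg :: "nat \<Rightarrow> ((nat \<Rightarrow> nat) \<Rightarrow> real) \<Rightarrow> real" where
  "perm_avg n F = (\<Sum>\<sigma> | \<sigma> permutes {..<n}. F \<sigma>) / fact n"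

lemma perm_avg_cong:
  "(\<And>\<sigma>. \<sigma> permutes {..<n} \<Longrightarrow> F \<sigma> = G \<sigma>) \<Longrightarrow> perm_avg n F = perm_avg n G"
  unfolding perm_avg_def by (auto intro!: sum.cong)

lemma perm_avg_const: "perm_avg n (\<lambda>_. c) = c"
  using card_permutations[of "{..<n}" n] by (simp add: perm_avg_def)

lemma perm_avg_sum: "perm_avg n (\<lambda>\<sigma>. \<Sum>i\<in>I. F i \<sigma>) = (\<Sum>i\<in>I. perm_avg n (F i))"
  unfolding perm_avg_def by (subst sum.swap) (simp add: sum_divide_distrib)

lemma perm_avg_cmult: "perm_avg n (\<lambda>\<sigma>. c * F \<sigma>) = c * perm_avg n F"
  by (simp add: perm_avg_def sum_distrib_left)

lemma perm_avg_add: "perm_avg n (\<lambda>\<sigma>. F \<sigma> + G \<sigma>) = perm_avg n F + perm_avg n G"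
  by (simp add: perm_avg_def sum.distrib add_divide_distrib)

lemma perm_avg_compose:
  "\<tau> permutes {..<n} \<Longrightarrow> perm_avg n (\<lambda>\<sigma>. F (\<sigma> \<circ> \<tau>)) = perm_avg n F"
  unfolding perm_avg_def by (subst sum_permutations_compose_right[of \<tau> "{..<n}" F]) auto

text \<open>For \<open>m\<close> outside \<open>I\<close> the average of \<open>\<phi> \<sigma> * h (\<sigma> m)\<close> does not depend on \<open>m\<close>, since one may
  swap two such indices; summing over all \<open>m < n\<close> turns this into a recursion.\<close>

lemma perm_avg_extend:
  assumes I: "I \<subseteq> {..<n}" and l: "l < n" "l \<notin> I"
    and \<phi>: "\<And>\<sigma> \<sigma>'. (\<And>i. i \<in> I \<Longrightarrow> \<sigma> i = \<sigma>' i) \<Longrightarrow> \<phi> \<sigma> = \<phi> \<sigma>'"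
  shows "(real n - real (card I)) * perm_avg n (\<lambda>\<sigma>. \<phi> \<sigma> * h (\<sigma> l))
       + (\<Sum>i\<in>I. perm_avg n (\<lambda>\<sigma>. \<phi> \<sigma> * h (\<sigma> i))) = (\<Sum>k<n. h k) * perm_avg n \<phi>"
proof -
  have const: "perm_avg n (\<lambda>\<sigma>. \<phi> \<sigma> * h (\<sigma> m)) = perm_avg n (\<lambda>\<sigma>. \<phi> \<sigma> * h (\<sigma> l))"
    if "m \<in> {..<n} - I" for m
  proof -
    let ?t = "transpose l m"
    have "?t permutes {..<n}" using l that by (intro permutes_swap_id) auto
    \<comment> \<open>Neither \<open>l\<close> nor \<open>m\<close> lies in \<open>I\<close>, so the
      swap does not affect the values on which \<open>\<phi>\<close> depends.\<close>
    moreover have "\<phi> (\<sigma> \<circ> ?t) = \<phi> \<sigma>" for \<sigma>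
      using l that by (intro \<phi>) (auto simp: transpose_def)
    ultimately show ?thesis
      using perm_avg_compose[of ?t n "\<lambda>\<sigma>. \<phi> \<sigma> * h (\<sigma> l)"] by simp
  qed
  have "(\<Sum>m<n. perm_avg n (\<lambda>\<sigma>. \<phi> \<sigma> * h (\<sigma> m))) = perm_avg n (\<lambda>\<sigma>. (\<Sum>k<n. h k) * \<phi> \<sigma>)"
    unfolding perm_avg_sum[symmetric]
  proof (rule perm_avg_cong)
    fix \<sigma> assume "\<sigma> permutes {..<n}"
    \<comment> \<open>A permutation only reorders the total of \<open>h\<close>, which is therefore
      a constant factor in the average.\<close>
    then have "(\<Sum>k<n. h (\<sigma> k)) = (\<Sum>k<n. h k)"
      using sum.permute[of \<sigma> "{..<n}" h] by (simp add: comp_def)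
    then show "(\<Sum>m<n. \<phi> \<sigma> * h (\<sigma> m)) = (\<Sum>k<n. h k) * \<phi> \<sigma>"
      by (simp flip: sum_distrib_left)
  qed
  moreover have "(\<Sum>m<n. perm_avg n (\<lambda>\<sigma>. \<phi> \<sigma> * h (\<sigma> m)))
      = (\<Sum>m\<in>{..<n} - I. perm_avg n (\<lambda>\<sigma>. \<phi> \<sigma> * h (\<sigma> m))) + (\<Sum>m\<in>I. perm_avg n (\<lambda>\<sigma>. \<phi> \<sigma> * h (\<sigma> m)))"
    using I by (intro sum.subset_diff) auto
  moreover have "card I \<le> n" using card_mono[OF _ I] by simp
  then have "real (card ({..<n} - I)) = real n - real (card I)"
    using I by (subst card_Diff_subset) (auto intro: finite_subset simp: of_nat_diff)
  then have "(\<Sum>m\<in>{..<n} - I. perm_avg n (\<lambda>\<sigma>. \<phi> \<sigma> * h (\<sigma> m)))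
      = (real n - real (card I)) * perm_avg n (\<lambda>\<sigma>. \<phi> \<sigma> * h (\<sigma> l))"
    using const by simp
  ultimately show ?thesis by (simp add: perm_avg_cmult)
qed

text \<open>Inclusion-exclusion over the coincidences among four indices.\<close>

lemma quartic_index_pattern:
  fixes T :: "'a \<Rightarrow> 'a \<Rightarrow> 'a \<Rightarrow> 'a \<Rightarrow> real"
  assumes "i \<in> S" "j \<in> S" "k \<in> S" "l \<in> S"
    and p4: "\<And>a. a \<in> S \<Longrightarrow> T a a a a = m4"
    and p31: "\<And>a b. \<lbrakk>a \<in> S; b \<in> S; a \<noteq> b\<rbrakk> \<Longrightarrow>
      T a a a b = m31 \<and> T a a b a = m31 \<and> T a b a a = m31 \<and> T b a a a = m31"
    and p22: "\<And>a b. \<lbrakk>a \<in> S; b \<in> S; a \<noteq> b\<rbrakk> \<Longrightarrow>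
      T a a b b = m22 \<and> T a b a b = m22 \<and> T a b b a = m22"
    and p211: "\<And>a b c. \<lbrakk>a \<in> S; b \<in> S; c \<in> S; a \<noteq> b; a \<noteq> c; b \<noteq> c\<rbrakk> \<Longrightarrow>
      T a a b c = m211 \<and> T a b a c = m211 \<and> T a b c a = m211 \<and>
      T b a a c = m211 \<and> T b a c a = m211 \<and> T b c a a = m211"
    and p1111: "\<And>a b c d. \<lbrakk>a \<in> S; b \<in> S; c \<in> S; d \<in> S; a \<noteq> b; a \<noteq> c; a \<noteq> d; b \<noteq> c; b \<noteq> d; c \<noteq> d\<rbrakk>
      \<Longrightarrow> T a b c d = m1111"
  shows "T i j k l = m1111
    + (m211 - m1111) * (of_bool (i = j) + of_bool (k = l) + of_bool (i = k) + of_bool (i = l) + of_bool (j = k) + of_bool (j = l))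
    + (m22 - 2 * m211 + m1111) * (of_bool (i = j \<and> k = l) + of_bool (i = k \<and> j = l) + of_bool (i = l \<and> j = k))
    + (m31 - 3 * m211 + 2 * m1111) * (of_bool (i = j \<and> j = k) + of_bool (i = j \<and> j = l) + of_bool (i = k \<and> k = l) + of_bool (j = k \<and> k = l))
    + (m4 - 4 * m31 - 3 * m22 + 12 * m211 - 6 * m1111) * of_bool (i = j \<and> j = k \<and> k = l)"
\<comment> \<open>The coefficients come from Mobius inversion on the set partitions of four
  positions, so on each pattern the sum collapses to the right moment. The cases compare
  \<open>j\<close> with \<open>i\<close>, then \<open>k\<close> and \<open>l\<close> with the
  earlier indices.\<close>
proof (cases "i = j")
  case True
  then show ?thesis
    using assms(1-4) p4[of i] p31[of i k] p31[of i l] p22[of i k] p211[of i k l]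
    by (cases "i = k"; cases "i = l"; cases "k = l") simp_all
next
  case False
  show ?thesis
  proof (cases "k = i \<or> k = j")
    case True
    then show ?thesis
      using assms(1-4) False p31[of i j] p31[of j i] p22[of i j] p22[of j i] p211[of i j l] p211[of j i l]
      by (cases "k = i"; cases "l = i"; cases "l = j") simp_all
  next
    case False
    then have k: "i \<noteq> k" "j \<noteq> k" "k \<noteq> i" "k \<noteq> j" by auto
    show ?thesis
    using assms(1-4) \<open>i \<noteq> j\<close> k p31[of i j] p31[of j i] p22[of i j] p211[of i j k] p211[of j i k] p211[of k i j]
      p1111[of i j k l]
    by (cases "l = i"; cases "l = j"; cases "l = k") simp_all
  qed
qed

section \<open>Symmetric averages of monomials in terms of power means\<close>

text \<open>The digits in the names are the exponents: \<open>avg211\<close> is the average of \<open>x\<^sub>i\<^sup>2 x\<^sub>j x\<^sub>k\<close> over distinct \<open>i, j, k\<close>.\<close>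

definition avg31 :: "nat \<Rightarrow> (nat \<Rightarrow> real) \<Rightarrow> real" where
  "avg31 n x = (real n * psum n 3 x * psum n 1 x - psum n 4 x) / (real n - 1)"

definition avg22 :: "nat \<Rightarrow> (nat \<Rightarrow> real) \<Rightarrow> real" where
  "avg22 n x = (real n * (psum n 2 x)\<^sup>2 - psum n 4 x) / (real n - 1)"

definition avg21 :: "nat \<Rightarrow> (nat \<Rightarrow> real) \<Rightarrow> real" where
  "avg21 n x = (real n * psum n 2 x * psum n 1 x - psum n 3 x) / (real n - 1)"

definition avg11 :: "nat \<Rightarrow> (nat \<Rightarrow> real) \<Rightarrow> real" where
  "avg11 n x = (real n * (psum n 1 x)\<^sup>2 - psum n 2 x) / (real n - 1)"

text \<open>Letting the last index run over everything multiplies \<open>avg21\<close> by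
  \<open>n\<close> times the first power mean. Collisions with the squared and with the simple index
  are subtracted as \<open>avg31\<close> and \<open>avg22\<close>, and \<open>n - 2\<close> free
  choices remain. \<open>avg111\<close> and \<open>avg1111\<close> follow the same
  recursion.\<close>

definition avg211 :: "nat \<Rightarrow> (nat \<Rightarrow> real) \<Rightarrow> real" where
  "avg211 n x = (real n * psum n 1 x * avg21 n x - avg31 n x - avg22 n x) / (real n - 2)"

definition avg111 :: "nat \<Rightarrow> (nat \<Rightarrow> real) \<Rightarrow> real" where
  "avg111 n x = (real n * psum n 1 x * avg11 n x - 2 * avg21 n x) / (real n - 2)"

definition avg1111 :: "nat \<Rightarrow> (nat \<Rightarrow> real) \<Rightarrow> real" where
  "avg1111 n x = (real n * psum n 1 x * avg111 n x - 3 * avg211 n x) / (real n - 3)"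

lemma sum_power_eq_psum: "n > 0 \<Longrightarrow> (\<Sum>k<n. x k ^ i) = real n * psum n i x"
  by (simp add: psum_def)

context
  fixes n :: nat and x :: "nat \<Rightarrow> real"
  assumes n: "n \<ge> 4"
begin

lemma perm_avg_pow:
  assumes "i < n"
  shows "perm_avg n (\<lambda>\<sigma>. x (\<sigma> i) ^ a) = psum n a x"
proof -
  have "real n * perm_avg n (\<lambda>\<sigma>. x (\<sigma> i) ^ a) = real n * psum n a x"
    using perm_avg_extend[of "{}" n i "\<lambda>_. 1" "\<lambda>k. x k ^ a"] assms n
    by (simp add: sum_power_eq_psum perm_avg_const)
  then show ?thesis using n by simp
qed

lemma perm_avg_pow_pow:
  assumes "i < n" "j < n" "i \<noteq> j"
  shows "perm_avg n (\<lambda>\<sigma>. x (\<sigma> i) ^ a * x (\<sigma> j) ^ b)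
    = (real n * psum n a x * psum n b x - psum n (a + b) x) / (real n - 1)"
proof -
  have "(real n - 1) * perm_avg n (\<lambda>\<sigma>. x (\<sigma> i) ^ a * x (\<sigma> j) ^ b) + psum n (a + b) x
     = real n * psum n b x * psum n a x"
    using perm_avg_extend[of "{i}" n j "\<lambda>\<sigma>. x (\<sigma> i) ^ a" "\<lambda>k. x k ^ b"] assms n
    by (simp add: sum_power_eq_psum perm_avg_pow flip: power_add)
  moreover have "real n - 1 \<noteq> 0" using n by simp
  ultimately show ?thesis by (simp add: field_simps)
qed

lemma perm_avg_11: "\<lbrakk>i < n; j < n; i \<noteq> j\<rbrakk> \<Longrightarrow> perm_avg n (\<lambda>\<sigma>. x (\<sigma> i) * x (\<sigma> j)) = avg11 n x"
  using perm_avg_pow_pow[of i j 1 1] by (simp add: avg11_def power2_eq_square numeral_2_eq_2 mult_ac)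

lemma perm_avg_21: "\<lbrakk>i < n; j < n; i \<noteq> j\<rbrakk> \<Longrightarrow> perm_avg n (\<lambda>\<sigma>. (x (\<sigma> i))\<^sup>2 * x (\<sigma> j)) = avg21 n x"
  using perm_avg_pow_pow[of i j 2 1] by (simp add: avg21_def)

lemma perm_avg_31: "\<lbrakk>i < n; j < n; i \<noteq> j\<rbrakk> \<Longrightarrow> perm_avg n (\<lambda>\<sigma>. x (\<sigma> i) ^ 3 * x (\<sigma> j)) = avg31 n x"
  using perm_avg_pow_pow[of i j 3 1] by (simp add: avg31_def)

lemma perm_avg_22: "\<lbrakk>i < n; j < n; i \<noteq> j\<rbrakk> \<Longrightarrow> perm_avg n (\<lambda>\<sigma>. (x (\<sigma> i))\<^sup>2 * (x (\<sigma> j))\<^sup>2) = avg22 n x"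
  using perm_avg_pow_pow[of i j 2 2] by (simp add: avg22_def power2_eq_square mult_ac)

lemma perm_avg_111:
  assumes "i < n" "j < n" "k < n" "i \<noteq> j" "i \<noteq> k" "j \<noteq> k"
  shows "perm_avg n (\<lambda>\<sigma>. x (\<sigma> i) * x (\<sigma> j) * x (\<sigma> k)) = avg111 n x"
proof -
  have eqs: "perm_avg n (\<lambda>\<sigma>. x (\<sigma> i) * x (\<sigma> j) * x (\<sigma> i)) = avg21 n x"
    "perm_avg n (\<lambda>\<sigma>. x (\<sigma> i) * x (\<sigma> j) * x (\<sigma> j)) = avg21 n x"
    using perm_avg_21[of i j] perm_avg_21[of j i] assms by (simp_all add: power2_eq_square mult_ac)
  have "(real n - 2) * perm_avg n (\<lambda>\<sigma>. x (\<sigma> i) * x (\<sigma> j) * x (\<sigma> k)) + (avg21 n x + avg21 n x)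
     = real n * psum n 1 x * avg11 n x"
    using perm_avg_extend[of "{i, j}" n k "\<lambda>\<sigma>. x (\<sigma> i) * x (\<sigma> j)" "\<lambda>k. x k"] assms n
      sum_power_eq_psum[of n x 1]
    by (simp add: eqs perm_avg_11)
  moreover have "real n - 2 \<noteq> 0" using n by simp
  ultimately show ?thesis by (simp add: avg111_def field_simps)
qed

lemma perm_avg_211:
  assumes "i < n" "j < n" "k < n" "i \<noteq> j" "i \<noteq> k" "j \<noteq> k"
  shows "perm_avg n (\<lambda>\<sigma>. (x (\<sigma> i))\<^sup>2 * x (\<sigma> j) * x (\<sigma> k)) = avg211 n x"
proof -
  \<comment> \<open>The new index may hit the squared variable, giving a cube, or the simple one,
    giving two squares.\<close>
  have eqs: "perm_avg n (\<lambda>\<sigma>. (x (\<sigma> i))\<^sup>2 * x (\<sigma> j) * x (\<sigma> i)) = avg31 n x"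
    "perm_avg n (\<lambda>\<sigma>. (x (\<sigma> i))\<^sup>2 * x (\<sigma> j) * x (\<sigma> j)) = avg22 n x"
    using perm_avg_31[of i j] perm_avg_22[of i j] assms
    by (simp_all add: power2_eq_square power3_eq_cube mult_ac)
  have "(real n - 2) * perm_avg n (\<lambda>\<sigma>. (x (\<sigma> i))\<^sup>2 * x (\<sigma> j) * x (\<sigma> k)) + (avg31 n x + avg22 n x)
     = real n * psum n 1 x * avg21 n x"
    using perm_avg_extend[of "{i, j}" n k "\<lambda>\<sigma>. (x (\<sigma> i))\<^sup>2 * x (\<sigma> j)" "\<lambda>k. x k"] assms n
      sum_power_eq_psum[of n x 1]
    by (simp add: eqs perm_avg_21)
  moreover have "real n - 2 \<noteq> 0" using n by simp
  ultimately show ?thesis by (simp add: avg211_def field_simps)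
qed

lemma perm_avg_1111:
  assumes "i < n" "j < n" "k < n" "l < n" "i \<noteq> j" "i \<noteq> k" "j \<noteq> k" "i \<noteq> l" "j \<noteq> l" "k \<noteq> l"
  shows "perm_avg n (\<lambda>\<sigma>. x (\<sigma> i) * x (\<sigma> j) * x (\<sigma> k) * x (\<sigma> l)) = avg1111 n x"
proof -
  \<comment> \<open>Whichever of the three old indices \<open>l\<close> hits, the result is a moment
    with exponents 2, 1, 1.\<close>
  have eqs: "perm_avg n (\<lambda>\<sigma>. x (\<sigma> i) * x (\<sigma> j) * x (\<sigma> k) * x (\<sigma> i)) = avg211 n x"
    "perm_avg n (\<lambda>\<sigma>. x (\<sigma> i) * x (\<sigma> j) * x (\<sigma> k) * x (\<sigma> j)) = avg211 n x"
    "perm_avg n (\<lambda>\<sigma>. x (\<sigma> i) * x (\<sigma> j) * x (\<sigma> k) * x (\<sigma> k)) = avg211 n x"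
    using perm_avg_211[of i j k] perm_avg_211[of j i k] perm_avg_211[of k i j] assms
    by (simp_all add: power2_eq_square mult_ac)
  have "(real n - 3) * perm_avg n (\<lambda>\<sigma>. x (\<sigma> i) * x (\<sigma> j) * x (\<sigma> k) * x (\<sigma> l))
      + 3 * avg211 n x = real n * psum n 1 x * avg111 n x"
    using perm_avg_extend[of "{i, j, k}" n l "\<lambda>\<sigma>. x (\<sigma> i) * x (\<sigma> j) * x (\<sigma> k)" "\<lambda>k. x k"] assms n
      sum_power_eq_psum[of n x 1]
    by (simp add: eqs perm_avg_111)
  moreover have "real n - 3 \<noteq> 0" using n by simp
  ultimately show ?thesis by (simp add: avg1111_def field_simps)
qed

text \<open>One formula valid for all index patterns, so that the fourfold sum for the average of a
  squared quadratic form can be evaluated without splitting its range.\<close>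

lemma perm_avg_quartic:
  assumes "i < n" "j < n" "k < n" "l < n"
  shows "perm_avg n (\<lambda>\<sigma>. x (\<sigma> i) * x (\<sigma> j) * x (\<sigma> k) * x (\<sigma> l)) = avg1111 n x
    + (avg211 n x - avg1111 n x)
      * (of_bool (i = j) + of_bool (k = l) + of_bool (i = k) + of_bool (i = l) + of_bool (j = k) + of_bool (j = l))
    + (avg22 n x - 2 * avg211 n x + avg1111 n x)
      * (of_bool (i = j \<and> k = l) + of_bool (i = k \<and> j = l) + of_bool (i = l \<and> j = k))
    + (avg31 n x - 3 * avg211 n x + 2 * avg1111 n x)
      * (of_bool (i = j \<and> j = k) + of_bool (i = j \<and> j = l) + of_bool (i = k \<and> k = l) + of_bool (j = k \<and> k = l))
    + (psum n 4 x - 4 * avg31 n x - 3 * avg22 n x + 12 * avg211 n x - 6 * avg1111 n x)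
      * of_bool (i = j \<and> j = k \<and> k = l)"
proof (rule quartic_index_pattern[where S = "{..<n}"])
  show "perm_avg n (\<lambda>\<sigma>. x (\<sigma> a) * x (\<sigma> a) * x (\<sigma> a) * x (\<sigma> a)) = psum n 4 x" if "a \<in> {..<n}" for a
    using perm_avg_pow[of a 4] that by (simp add: power4_eq_xxxx)
next
  fix a b assume "a \<in> {..<n}" "b \<in> {..<n}" "a \<noteq> b"
  then show "perm_avg n (\<lambda>\<sigma>. x (\<sigma> a) * x (\<sigma> a) * x (\<sigma> a) * x (\<sigma> b)) = avg31 n x \<and>
    perm_avg n (\<lambda>\<sigma>. x (\<sigma> a) * x (\<sigma> a) * x (\<sigma> b) * x (\<sigma> a)) = avg31 n x \<and>
    perm_avg n (\<lambda>\<sigma>. x (\<sigma> a) * x (\<sigma> b) * x (\<sigma> a) * x (\<sigma> a)) = avg31 n x \<and>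
    perm_avg n (\<lambda>\<sigma>. x (\<sigma> b) * x (\<sigma> a) * x (\<sigma> a) * x (\<sigma> a)) = avg31 n x"
    using perm_avg_31[of a b] by (simp add: power3_eq_cube mult_ac)
next
  fix a b assume "a \<in> {..<n}" "b \<in> {..<n}" "a \<noteq> b"
  then show "perm_avg n (\<lambda>\<sigma>. x (\<sigma> a) * x (\<sigma> a) * x (\<sigma> b) * x (\<sigma> b)) = avg22 n x \<and>
    perm_avg n (\<lambda>\<sigma>. x (\<sigma> a) * x (\<sigma> b) * x (\<sigma> a) * x (\<sigma> b)) = avg22 n x \<and>
    perm_avg n (\<lambda>\<sigma>. x (\<sigma> a) * x (\<sigma> b) * x (\<sigma> b) * x (\<sigma> a)) = avg22 n x"
    using perm_avg_22[of a b] by (simp add: power2_eq_square mult_ac)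
next
  fix a b c assume "a \<in> {..<n}" "b \<in> {..<n}" "c \<in> {..<n}" "a \<noteq> b" "a \<noteq> c" "b \<noteq> c"
  then show "perm_avg n (\<lambda>\<sigma>. x (\<sigma> a) * x (\<sigma> a) * x (\<sigma> b) * x (\<sigma> c)) = avg211 n x \<and>
    perm_avg n (\<lambda>\<sigma>. x (\<sigma> a) * x (\<sigma> b) * x (\<sigma> a) * x (\<sigma> c)) = avg211 n x \<and>
    perm_avg n (\<lambda>\<sigma>. x (\<sigma> a) * x (\<sigma> b) * x (\<sigma> c) * x (\<sigma> a)) = avg211 n x \<and>
    perm_avg n (\<lambda>\<sigma>. x (\<sigma> b) * x (\<sigma> a) * x (\<sigma> a) * x (\<sigma> c)) = avg211 n x \<and>
    perm_avg n (\<lambda>\<sigma>. x (\<sigma> b) * x (\<sigma> a) * x (\<sigma> c) * x (\<sigma> a)) = avg211 n x \<and>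
    perm_avg n (\<lambda>\<sigma>. x (\<sigma> b) * x (\<sigma> c) * x (\<sigma> a) * x (\<sigma> a)) = avg211 n x"
    using perm_avg_211[of a b c] by (simp add: power2_eq_square mult_ac)
next
  fix a b c d assume "a \<in> {..<n}" "b \<in> {..<n}" "c \<in> {..<n}" "d \<in> {..<n}"
    "a \<noteq> b" "a \<noteq> c" "a \<noteq> d" "b \<noteq> c" "b \<noteq> d" "c \<noteq> d"
  then show "perm_avg n (\<lambda>\<sigma>. x (\<sigma> a) * x (\<sigma> b) * x (\<sigma> c) * x (\<sigma> d)) = avg1111 n x"
    using perm_avg_1111[of a b c d] by simp
qed (use assms in auto)

end

section \<open>Contraction of the index patterns with a symmetric matrix\<close>

lemma sum_times_of_bool_eq:
  fixes F :: "nat \<Rightarrow> real"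
  assumes "i < n"
  shows "(\<Sum>k<n. F k * of_bool (i = k)) = F i" "(\<Sum>k<n. F k * of_bool (k = i)) = F i"
  using assms by (simp_all add: of_bool_def if_distrib[of "\<lambda>y. _ * y"] cong: if_cong)

lemma quartic_contraction_inner:
  fixes A :: "nat \<Rightarrow> nat \<Rightarrow> real"
  assumes sym: "\<And>i j. A i j = A j i" and ij: "i < n" "j < n"
  shows "(\<Sum>k<n. \<Sum>l<n. A k l * (c0
    + c1 * (of_bool (i = j) + of_bool (k = l) + of_bool (i = k) + of_bool (i = l) + of_bool (j = k) + of_bool (j = l))
    + c2 * (of_bool (i = j \<and> k = l) + of_bool (i = k \<and> j = l) + of_bool (i = l \<and> j = k))
    + c3 * (of_bool (i = j \<and> j = k) + of_bool (i = j \<and> j = l) + of_bool (i = k \<and> k = l) + of_bool (j = k \<and> k = l))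
    + c4 * of_bool (i = j \<and> j = k \<and> k = l)))
    = c0 * (\<Sum>k<n. \<Sum>l<n. A k l)
    + c1 * (of_bool (i = j) * (\<Sum>k<n. \<Sum>l<n. A k l) + (\<Sum>k<n. A k k) + 2 * (\<Sum>l<n. A i l) + 2 * (\<Sum>l<n. A j l))
    + c2 * (of_bool (i = j) * (\<Sum>k<n. A k k) + 2 * A i j)
    + c3 * (2 * (of_bool (i = j) * (\<Sum>l<n. A i l)) + A i i + A j j)
    + c4 * (of_bool (i = j) * A i i)"
proof -
  \<comment> \<open>\<open>S\<close> is linear in its kernel, so it is enough to evaluate it on the
    separate indicator functions.\<close>
  define S where "S F = (\<Sum>k<n. \<Sum>l<n. A k l * F k l)" for F :: "nat \<Rightarrow> nat \<Rightarrow> real"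
  have S1: "S (\<lambda>k l. of_bool (k = l)) = (\<Sum>k<n. A k k)"
    unfolding S_def by (intro sum.cong refl) (simp add: sum_times_of_bool_eq)
  have S2: "S (\<lambda>k l. of_bool (a = k)) = (\<Sum>l<n. A a l)" if "a < n" for a
    unfolding S_def sum_distrib_right[symmetric] using that by (simp add: sum_times_of_bool_eq)
  \<comment> \<open>Fixing the second index gives a column sum, which symmetry turns into a row
    sum.\<close>
  have S3: "S (\<lambda>k l. of_bool (a = l)) = (\<Sum>l<n. A a l)" if "a < n" for a
    unfolding S_def using that sym by (simp add: sum_times_of_bool_eq)
  have S4: "S (\<lambda>k l. of_bool (a = k) * of_bool (b = l)) = A a b" if "a < n" "b < n" for a b
    unfolding S_def using that
    by (simp only: mult.assoc[symmetric] sum_times_of_bool_eq)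
  have S5: "S (\<lambda>k l. of_bool (a = k) * of_bool (k = l)) = A a a" if "a < n" for a
  proof -
    have "S (\<lambda>k l. of_bool (a = k) * of_bool (k = l)) = (\<Sum>k<n. A k k * of_bool (a = k))"
      unfolding S_def by (intro sum.cong refl) (simp add: sum_times_of_bool_eq flip: mult.assoc)
    then show ?thesis using that by (simp add: sum_times_of_bool_eq)
  qed
  \<comment> \<open>Writing conjunctions as products exposes the factors free of \<open>k\<close>
    and \<open>l\<close>, which linearity pulls out.\<close>
  have conj: "of_bool (P \<and> Q) = of_bool P * (of_bool Q :: real)" for P Q by simp
  have lin: "S (\<lambda>k l. F k l + G k l) = S F + S G" "S (\<lambda>k l. c * F k l) = c * S F"
    "S (\<lambda>k l. c) = c * (\<Sum>k<n. \<Sum>l<n. A k l)" for F G c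
    by (simp_all add: S_def distrib_left sum.distrib sum_distrib_left mult_ac)
  have S4': "S (\<lambda>k l. of_bool (a = l) * of_bool (b = k)) = A b a" if "a < n" "b < n" for a b
    using S4[OF that(2,1)] by (simp only: mult.commute)
  show ?thesis
    unfolding S_def[symmetric] conj lin
    using sym[of j i] ij by (cases "i = j") (simp_all add: S1 S2 S3 S4 S4' S5)
qed

text \<open>The multiplicities count coincidences. Among pairs, \<open>i = j\<close> and
  \<open>k = l\<close> give trace times total, and the four mixed ones give squared row sums. Of the
  three double pairs one gives the squared trace and two the squared entries. Each of the four
  triples pairs the diagonal with the row sums.\<close>

lemma quartic_contraction:
  fixes A :: "nat \<Rightarrow> nat \<Rightarrow> real"
  assumes sym: "\<And>i j. A i j = A j i"
  shows "(\<Sum>i<n. \<Sum>j<n. \<Sum>k<n. \<Sum>l<n. A i j * A k l * (c0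
    + c1 * (of_bool (i = j) + of_bool (k = l) + of_bool (i = k) + of_bool (i = l) + of_bool (j = k) + of_bool (j = l))
    + c2 * (of_bool (i = j \<and> k = l) + of_bool (i = k \<and> j = l) + of_bool (i = l \<and> j = k))
    + c3 * (of_bool (i = j \<and> j = k) + of_bool (i = j \<and> j = l) + of_bool (i = k \<and> k = l) + of_bool (j = k \<and> k = l))
    + c4 * of_bool (i = j \<and> j = k \<and> k = l)))
    = c0 * (\<Sum>i<n. \<Sum>j<n. A i j)\<^sup>2
    + c1 * (2 * (\<Sum>i<n. A i i) * (\<Sum>i<n. \<Sum>j<n. A i j) + 4 * (\<Sum>i<n. (\<Sum>j<n. A i j)\<^sup>2))
    + c2 * ((\<Sum>i<n. A i i)\<^sup>2 + 2 * (\<Sum>i<n. \<Sum>j<n. (A i j)\<^sup>2))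
    + c3 * (4 * (\<Sum>i<n. A i i * (\<Sum>j<n. A i j)))
    + c4 * (\<Sum>i<n. (A i i)\<^sup>2)" (is "?lhs = _")
proof -
  define s t r where "s = (\<Sum>i<n. \<Sum>j<n. A i j)" and "t = (\<Sum>i<n. A i i)" and "r = (\<lambda>i. \<Sum>j<n. A i j)"
  have "?lhs = (\<Sum>i<n. \<Sum>j<n. A i j * (c0 * s
    + c1 * (of_bool (i = j) * s + t + 2 * r i + 2 * r j)
    + c2 * (of_bool (i = j) * t + 2 * A i j)
    + c3 * (2 * (of_bool (i = j) * r i) + A i i + A j j)
    + c4 * (of_bool (i = j) * A i i)))"
    unfolding s_def t_def r_def mult.assoc sum_distrib_left[symmetric]
    by (rule sum.cong[OF refl], rule sum.cong[OF refl], rule arg_cong2[where f = "(*)", OF refl],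
        rule quartic_contraction_inner) (rule sym | simp)+
  also have "\<dots> = (\<Sum>i<n. r i * (c0 * s + c1 * t + 2 * c1 * r i + c3 * A i i)
      + A i i * (c1 * s + c2 * t + 2 * c3 * r i + c4 * A i i)
      + 2 * c2 * (\<Sum>j<n. (A i j)\<^sup>2) + (\<Sum>j<n. A i j * (2 * c1 * r j + c3 * A j j)))"
  proof (intro sum.cong refl)
    fix i assume i: "i \<in> {..<n}"
    let ?R = "c0 * s + c1 * t + 2 * c1 * r i + c3 * A i i"
    let ?D = "c1 * s + c2 * t + 2 * c3 * r i + c4 * A i i"
    \<comment> \<open>The terms are sorted into those constant in \<open>j\<close>
      (\<open>?R\<close>), those on the diagonal (\<open>?D\<close>), the square of the entry, and
      those that depend on \<open>j\<close> through \<open>r j\<close> and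
      \<open>A j j\<close>.\<close>
    have "(\<Sum>j<n. A i j * (c0 * s + c1 * (of_bool (i = j) * s + t + 2 * r i + 2 * r j)
      + c2 * (of_bool (i = j) * t + 2 * A i j) + c3 * (2 * (of_bool (i = j) * r i) + A i i + A j j)
      + c4 * (of_bool (i = j) * A i i)))
      = (\<Sum>j<n. A i j * ?R + (A i j * ?D) * of_bool (i = j)
          + 2 * c2 * (A i j)\<^sup>2 + A i j * (2 * c1 * r j + c3 * A j j))"
      by (intro sum.cong refl) (simp add: algebra_simps power2_eq_square)
    also have "\<dots> = r i * ?R + A i i * ?D + 2 * c2 * (\<Sum>j<n. (A i j)\<^sup>2)
        + (\<Sum>j<n. A i j * (2 * c1 * r j + c3 * A j j))"
      unfolding sum.distrib sum_distrib_left[symmetric] sum_distrib_right[symmetric] r_def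
      using i by (simp add: sum_times_of_bool_eq)
    finally show "(\<Sum>j<n. A i j * (c0 * s + c1 * (of_bool (i = j) * s + t + 2 * r i + 2 * r j)
      + c2 * (of_bool (i = j) * t + 2 * A i j) + c3 * (2 * (of_bool (i = j) * r i) + A i i + A j j)
      + c4 * (of_bool (i = j) * A i i)))
      = r i * ?R + A i i * ?D + 2 * c2 * (\<Sum>j<n. (A i j)\<^sup>2)
        + (\<Sum>j<n. A i j * (2 * c1 * r j + c3 * A j j))" .
  qed
  also have "\<dots> = (\<Sum>i<n. r i * (c0 * s + c1 * t + 2 * c1 * r i + c3 * A i i)
      + A i i * (c1 * s + c2 * t + 2 * c3 * r i + c4 * A i i)
      + 2 * c2 * (\<Sum>j<n. (A i j)\<^sup>2)) + (\<Sum>j<n. r j * (2 * c1 * r j + c3 * A j j))"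
  proof -
    \<comment> \<open>After the exchange of sums the factor of \<open>A i j\<close> does not involve
      \<open>i\<close>, and the column sums equal the row sums by symmetry.\<close>
    have "(\<Sum>i<n. \<Sum>j<n. A i j * (2 * c1 * r j + c3 * A j j))
        = (\<Sum>j<n. \<Sum>i<n. A i j * (2 * c1 * r j + c3 * A j j))" by (rule sum.swap)
    also have "\<dots> = (\<Sum>j<n. r j * (2 * c1 * r j + c3 * A j j))"
      unfolding sum_distrib_right[symmetric] r_def using sym by simp
    finally show ?thesis by (simp add: sum.distrib)
  qed
  also have "\<dots> = (\<Sum>i<n. (c0 * s + c1 * t) * r i + (c1 * s + c2 * t) * A i i + 4 * c1 * (r i)\<^sup>2
      + 4 * c3 * (A i i * r i) + c4 * (A i i)\<^sup>2 + 2 * c2 * (\<Sum>j<n. (A i j)\<^sup>2))"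
    unfolding sum.distrib[symmetric]
    by (intro sum.cong refl) (simp add: algebra_simps power2_eq_square)
  also have "\<dots> = (c0 * s + c1 * t) * s + (c1 * s + c2 * t) * t + 4 * c1 * (\<Sum>i<n. (r i)\<^sup>2)
      + 4 * c3 * (\<Sum>i<n. A i i * r i) + c4 * (\<Sum>i<n. (A i i)\<^sup>2) + 2 * c2 * (\<Sum>i<n. \<Sum>j<n. (A i j)\<^sup>2)"
    unfolding sum.distrib sum_distrib_left[symmetric] by (simp add: s_def t_def r_def)
  also have "\<dots> = c0 * s\<^sup>2 + c1 * (2 * t * s + 4 * (\<Sum>i<n. (r i)\<^sup>2))
      + c2 * (t\<^sup>2 + 2 * (\<Sum>i<n. \<Sum>j<n. (A i j)\<^sup>2))
      + c3 * (4 * (\<Sum>i<n. A i i * r i)) + c4 * (\<Sum>i<n. (A i i)\<^sup>2)"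
    by (simp add: algebra_simps power2_eq_square)
  finally show ?thesis by (simp only: s_def t_def r_def)
qed

section \<open>Rational identities between the moments\<close>

text \<open>The power means become free reals here. The seven conclusions evaluate, in this order,
  the coefficients of \<open>uu\<close>, \<open>uv\<close>, \<open>vv\<close>,
  \<open>U\<^sup>2\<close>, \<open>U * V\<close>, \<open>V\<^sup>2\<close> and \<open>bb\<close> in
  \<open>sos_cone_square_average\<close>.\<close>

lemma moment_coefficient_identities:
  fixes n p1 p2 p3 p4 :: real
  assumes n: "n > 3"
  defines "t31 \<equiv> (n * p3 * p1 - p4) / (n - 1)"
    and "t22 \<equiv> (n * p2\<^sup>2 - p4) / (n - 1)"
    and "t21 \<equiv> (n * p2 * p1 - p3) / (n - 1)"
    and "t11 \<equiv> (n * p1\<^sup>2 - p2) / (n - 1)"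
  defines "t211 \<equiv> (n * p1 * t21 - t31 - t22) / (n - 2)"
    and "t111 \<equiv> (n * p1 * t11 - 2 * t21) / (n - 2)"
  defines "t1111 \<equiv> (n * p1 * t111 - 3 * t211) / (n - 3)"
  shows "p4 - t22 = n / (n - 1) * (p4 - p2\<^sup>2)"
    and "4 * (t211 - t1111) + 4 * (t22 - 2 * t211 + t1111) / n + 4 * (t31 - 3 * t211 + 2 * t1111) * (1 / 2 + 1 / n)
       + 2 * (p4 - 4 * t31 - 3 * t22 + 12 * t211 - 6 * t1111) / n = 2 * (n / (n - 1)) * (p3 * p1 - p2 * p1\<^sup>2)"
    and "(t211 - t1111) + (t22 - 2 * t211 + t1111) / n + 2 * (t31 - 3 * t211 + 2 * t1111) / n
       + (p4 - 4 * t31 - 3 * t22 + 12 * t211 - 6 * t1111) / n\<^sup>2 = n / (n - 1) * (p2 * p1\<^sup>2 - p1 ^ 4)"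
    and "t22 = p2\<^sup>2 - 1 / (n - 1) * (p4 - p2\<^sup>2)"
    and "2 * t1111 + 2 * (t211 - t1111) * (1 + 3 / n) + 2 * (t22 - 2 * t211 + t1111) / n + 2 * (t31 - 3 * t211 + 2 * t1111) / n
       = 2 * p2 * p1\<^sup>2 - 2 / (n - 1) * (p3 * p1 - p2 * p1\<^sup>2)"
    and "t1111 + 5 * (t211 - t1111) / n + 2 * (t22 - 2 * t211 + t1111) / n\<^sup>2 + 2 * (t31 - 3 * t211 + 2 * t1111) / n\<^sup>2
       = p1 ^ 4 - 1 / (n - 1) * (p2 * p1\<^sup>2 - p1 ^ 4)"
    and "2 * (t22 - 2 * t211 + t1111) = 4 * n ^ 3 / ((n - 1) * (n - 2) * (n - 3))
       * (1/2 * p1^4 - p2 * p1^2 + (n ^ 2 - 3 * n + 3) / (2 * n ^ 2) * p2^2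
                 + (2 * n - 2) / n ^ 2 * (p3 * p1) + (1 - n) / (2 * n ^ 2) * p4)"
proof -
  have nz: "n \<noteq> 0" "n - 1 \<noteq> 0" "n - 2 \<noteq> 0" "n - 3 \<noteq> 0" using n by auto
  \<comment> \<open>A common denominator of all moments; kept opaque, it leaves only
    \<open>n\<close> and \<open>K\<close> to be cleared.\<close>
  define K where "K = (n - 1) * (n - 2) * (n - 3)"
  have K: "K \<noteq> 0" using nz by (simp add: K_def)
  show "p4 - t22 = n / (n - 1) * (p4 - p2\<^sup>2)" "t22 = p2\<^sup>2 - 1 / (n - 1) * (p4 - p2\<^sup>2)"
    using nz(2) by (simp_all add: t22_def divide_simps) (simp_all add: algebra_simps)
  have t211: "t211 = (n\<^sup>2 * p1\<^sup>2 * p2 - n * p2\<^sup>2 - 2 * n * p3 * p1 + 2 * p4) / ((n - 1) * (n - 2))"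
    using nz(2,3) unfolding t211_def t21_def t31_def t22_def
    by (simp add: divide_simps) (simp add: algebra_simps power2_eq_square)
  \<comment> \<open>Up to a power of \<open>n\<close>, the numerator is Newton's expansion of 24
    times the fourth elementary symmetric polynomial: 1, -6, 3, 8, -6 are the signed numbers of
    permutations of four letters by cycle type.\<close>
  have t1111: "t1111 = (n ^ 3 * p1 ^ 4 - 6 * n\<^sup>2 * p2 * p1\<^sup>2 + 3 * n * p2\<^sup>2 + 8 * n * p3 * p1 - 6 * p4) / K"
    using nz(2,3,4) unfolding t1111_def t111_def t211 t21_def t11_def K_def
    by (simp add: divide_simps) algebra
  have K31: "t31 = (n * p3 * p1 - p4) * ((n - 2) * (n - 3)) / K"
    and K22: "t22 = (n * p2\<^sup>2 - p4) * ((n - 2) * (n - 3)) / K"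
    and K211: "t211 = (n\<^sup>2 * p1\<^sup>2 * p2 - n * p2\<^sup>2 - 2 * n * p3 * p1 + 2 * p4) * (n - 3) / K"
    using nz unfolding t31_def t22_def t211 K_def by simp_all
  have Kn: "1 / (n - 1) = (n - 2) * (n - 3) / K" "n / (n - 1) = n * ((n - 2) * (n - 3)) / K"
     "2 / (n - 1) = 2 * ((n - 2) * (n - 3)) / K" using nz unfolding K_def by (auto simp: divide_simps)
  note K_eqs = K31 K22 K211 t1111 Kn K_def[symmetric]
  show "4 * (t211 - t1111) + 4 * (t22 - 2 * t211 + t1111) / n + 4 * (t31 - 3 * t211 + 2 * t1111) * (1 / 2 + 1 / n)
       + 2 * (p4 - 4 * t31 - 3 * t22 + 12 * t211 - 6 * t1111) / n = 2 * (n / (n - 1)) * (p3 * p1 - p2 * p1\<^sup>2)"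
    unfolding K_eqs using nz(1) K by (simp add: divide_simps) (use K_def in algebra)
  show "(t211 - t1111) + (t22 - 2 * t211 + t1111) / n + 2 * (t31 - 3 * t211 + 2 * t1111) / n
       + (p4 - 4 * t31 - 3 * t22 + 12 * t211 - 6 * t1111) / n\<^sup>2 = n / (n - 1) * (p2 * p1\<^sup>2 - p1 ^ 4)"
    unfolding K_eqs using nz(1) K by (simp add: divide_simps) (use K_def in algebra)
  show "2 * t1111 + 2 * (t211 - t1111) * (1 + 3 / n) + 2 * (t22 - 2 * t211 + t1111) / n + 2 * (t31 - 3 * t211 + 2 * t1111) / n
       = 2 * p2 * p1\<^sup>2 - 2 / (n - 1) * (p3 * p1 - p2 * p1\<^sup>2)"
    unfolding K_eqs using nz(1) K by (simp add: divide_simps) (use K_def in algebra)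
  show "t1111 + 5 * (t211 - t1111) / n + 2 * (t22 - 2 * t211 + t1111) / n\<^sup>2 + 2 * (t31 - 3 * t211 + 2 * t1111) / n\<^sup>2
       = p1 ^ 4 - 1 / (n - 1) * (p2 * p1\<^sup>2 - p1 ^ 4)"
    unfolding K_eqs using nz(1) K by (simp add: divide_simps) (use K_def in algebra)
  show "2 * (t22 - 2 * t211 + t1111) = 4 * n ^ 3 / ((n - 1) * (n - 2) * (n - 3))
       * (1/2 * p1^4 - p2 * p1^2 + (n ^ 2 - 3 * n + 3) / (2 * n ^ 2) * p2^2
                 + (2 * n - 2) / n ^ 2 * (p3 * p1) + (1 - n) / (2 * n ^ 2) * p4)"
    unfolding K_eqs using nz(1) K by (simp add: divide_simps) (simp add: algebra_simps power2_eq_square power3_eq_cube power4_eq_xxxx)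
qed

section \<open>Isotypic decomposition of the coefficient matrix\<close>

text \<open>Splitting of the quadratic forms into the isotypic parts of the symmetric group: \<open>u\<close> carries
  the forms \<open>x\<^sub>i\<^sup>2\<close>, \<open>v\<close> the forms \<open>p\<^sub>1 x\<^sub>i\<close>, and \<open>B\<close> lies in the Specht module of shape \<open>(n - 2, 2)\<close>.\<close>

lemma symmetric_matrix_decomposition:
  fixes A :: "nat \<Rightarrow> nat \<Rightarrow> real"
  assumes "n \<ge> 3" and sym: "\<And>i j. A i j = A j i"
  obtains u v B where "\<And>i j. A i j = of_bool (i = j) * u i + (v i + v j) / (2 * real n) + B i j"
    "\<And>i j. B i j = B j i" "\<And>i. B i i = 0" "\<forall>i<n. (\<Sum>j<n. B i j) = 0"
proof -
  \<comment> \<open>Zero row sums of \<open>B\<close> mean \<open>r i = (n - 2) * w i + W\<close>,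
    where \<open>W\<close> is the sum of all \<open>w i\<close>; summing over \<open>i\<close> gives
    \<open>(2 * n - 2) * W\<close> for the sum of all \<open>r i\<close>. Solving these equations
    yields \<open>W\<close> and \<open>w\<close>.\<close>
  define r where "r i = (\<Sum>j<n. A i j) - A i i" for i
  define W where "W = (\<Sum>i<n. r i) / (2 * real n - 2)"
  define w where "w i = (r i - W) / (real n - 2)" for i
  define B where "B i j = (if i = j then 0 else A i j - w i - w j)" for i j
  have nz: "real n - 2 \<noteq> 0" "2 * real n - 2 \<noteq> 0" "real n \<noteq> 0" using assms(1) by auto
  have "(real n - 2) * (\<Sum>i<n. w i) = (\<Sum>i<n. r i) - real n * W"
    using nz by (simp add: w_def sum_subtractf flip: sum_divide_distrib)
  also have "(\<Sum>i<n. r i) = (2 * real n - 2) * W" using nz by (simp add: W_def)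
  finally have "(real n - 2) * (\<Sum>i<n. w i) = (real n - 2) * W" by (simp add: algebra_simps)
  then have W: "(\<Sum>i<n. w i) = W" using nz by simp
  have "\<forall>i<n. (\<Sum>j<n. B i j) = 0"
  proof (intro allI impI)
    fix i assume i: "i < n"
    have "(\<Sum>j<n. B i j) = (\<Sum>j\<in>{..<n} - {i}. A i j - w i - w j)"
      unfolding B_def using i by (subst sum.remove[of _ i]) (auto intro!: sum.cong)
    also have "\<dots> = (\<Sum>j<n. A i j - w i - w j) - (A i i - 2 * w i)"
      using i by (subst sum.remove[of "{..<n}" i]) auto
    also have "\<dots> = r i - W - (real n - 2) * w i"
      by (simp add: sum_subtractf sum.distrib W r_def algebra_simps)
    also have "\<dots> = 0" using nz by (simp add: w_def)
    finally show "(\<Sum>j<n. B i j) = 0" .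
  qed
  \<comment> \<open>The linear form with coefficients \<open>v\<close>, times the first power mean,
    has the symmetric matrix \<open>(v i + v j) / (2 * n)\<close>; hence \<open>v\<close> is
    \<open>w\<close> scaled by \<open>2 * n\<close>, and the diagonal loses \<open>2 * w i\<close>
    to it.\<close>
  moreover have "A i j = of_bool (i = j) * (A i i - 2 * w i) + (2 * real n * w i + 2 * real n * w j) / (2 * real n) + B i j" for i j
    using nz by (simp add: B_def add_divide_distrib)
  moreover have "B i j = B j i" "B i i = 0" for i j using sym by (simp_all add: B_def)
  ultimately show thesis
    by (intro that[of "\<lambda>i. A i i - 2 * w i" "\<lambda>i. 2 * real n * w i" B])
qed

text \<open>These are the invariants on the right of \<open>quartic_contraction\<close>. Zero
  diagonal and zero row sums make \<open>B\<close> drop out of all of them except the sum of squared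
  entries, where its own squared norm is added.\<close>

lemma decomposed_matrix_sums:
  fixes u v :: "nat \<Rightarrow> real"
  assumes n: "n > 0"
    and A: "\<And>i j. A i j = of_bool (i = j) * u i + (v i + v j) / (2 * real n) + B i j"
    and B: "\<And>i j. B i j = B j i" "\<And>i. B i i = 0" "\<forall>i<n. (\<Sum>j<n. B i j) = 0"
  defines "U \<equiv> \<Sum>i<n. u i" and "V \<equiv> \<Sum>i<n. v i"
    and "uu \<equiv> \<Sum>i<n. (u i)\<^sup>2" and "uv \<equiv> \<Sum>i<n. u i * v i" and "vv \<equiv> \<Sum>i<n. (v i)\<^sup>2"
  shows "(\<Sum>i<n. \<Sum>j<n. A i j) = U + V"
    and "(\<Sum>i<n. A i i) = U + V / real n"
    and "(\<Sum>i<n. (\<Sum>j<n. A i j)\<^sup>2) = uu + uv + vv / 4 + U * V / real n + 3 * V\<^sup>2 / (4 * real n)"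
    and "(\<Sum>i<n. A i i * (\<Sum>j<n. A i j))
      = uu + uv * (1 / 2 + 1 / real n) + vv / (2 * real n) + U * V / (2 * real n) + V\<^sup>2 / (2 * (real n)\<^sup>2)"
    and "(\<Sum>i<n. (A i i)\<^sup>2) = uu + 2 * uv / real n + vv / (real n)\<^sup>2"
    and "(\<Sum>i<n. \<Sum>j<n. (A i j)\<^sup>2)
      = uu + 2 * uv / real n + vv / (2 * real n) + V\<^sup>2 / (2 * (real n)\<^sup>2) + (\<Sum>i<n. \<Sum>j<n. (B i j)\<^sup>2)"
proof -
  define m where "m = real n"
  have m: "m \<noteq> 0" using n by (simp add: m_def)
  have diag: "A i i = u i + v i / m" for i by (simp add: A B(2) m_def)
  have row: "(\<Sum>j<n. A i j) = u i + v i / 2 + V / (2 * m)" if "i < n" for i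
  proof -
    have "(\<Sum>j<n. A i j) = (\<Sum>j<n. u i * of_bool (i = j)) + (\<Sum>j<n. v i / (2 * m)) + (\<Sum>j<n. v j) / (2 * m) + (\<Sum>j<n. B i j)"
      unfolding A sum_divide_distrib sum.distrib[symmetric] m_def
      by (intro sum.cong refl) (simp add: add_divide_distrib)
    also have "\<dots> = u i + m * (v i / (2 * m)) + V / (2 * m)"
      using B(3)[rule_format, OF that] sum_times_of_bool_eq(1)[OF that, of "\<lambda>_. u i"] by (simp add: m_def V_def)
    finally show ?thesis using m by simp
  qed
  show "(\<Sum>i<n. \<Sum>j<n. A i j) = U + V"
    using m by (simp add: row sum.distrib U_def V_def sum_divide_distrib[symmetric] m_def)
  show "(\<Sum>i<n. A i i) = U + V / real n"
    by (simp add: diag sum.distrib U_def V_def sum_divide_distrib m_def)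
  have "(\<Sum>i<n. (\<Sum>j<n. A i j)\<^sup>2) = (\<Sum>i<n. (u i)\<^sup>2 + u i * v i + (v i)\<^sup>2 / 4 + u i * (V / m) + v i * (V / (2 * m)) + (V / (2 * m))\<^sup>2)"
    using m by (intro sum.cong refl) (simp add: row power2_eq_square field_simps)
  also have "\<dots> = uu + uv + vv / 4 + U * (V / m) + V * (V / (2 * m)) + m * (V / (2 * m))\<^sup>2"
    unfolding sum.distrib sum_divide_distrib[symmetric] sum_distrib_right[symmetric]
    by (simp add: uu_def uv_def vv_def U_def V_def m_def)
  also have "\<dots> = uu + uv + vv / 4 + U * V / m + 3 * V\<^sup>2 / (4 * m)"
    using m by (simp add: power2_eq_square field_simps)
  finally show "(\<Sum>i<n. (\<Sum>j<n. A i j)\<^sup>2) = uu + uv + vv / 4 + U * V / real n + 3 * V\<^sup>2 / (4 * real n)"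
    by (simp only: m_def)
  have "(\<Sum>i<n. A i i * (\<Sum>j<n. A i j))
     = (\<Sum>i<n. (u i)\<^sup>2 + (u i * v i) * (1 / 2 + 1 / m) + (v i)\<^sup>2 / (2 * m) + u i * (V / (2 * m)) + v i * (V / (2 * m\<^sup>2)))"
    using m by (intro sum.cong refl) (simp add: diag row power2_eq_square field_simps)
  also have "\<dots> = uu + uv * (1 / 2 + 1 / m) + vv / (2 * m) + U * (V / (2 * m)) + V * (V / (2 * m\<^sup>2))"
    unfolding sum.distrib sum_divide_distrib[symmetric] sum_distrib_right[symmetric]
    by (simp add: uu_def uv_def vv_def U_def V_def)
  finally show "(\<Sum>i<n. A i i * (\<Sum>j<n. A i j))
      = uu + uv * (1 / 2 + 1 / real n) + vv / (2 * real n) + U * V / (2 * real n) + V\<^sup>2 / (2 * (real n)\<^sup>2)"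
    by (simp add: m_def power2_eq_square)
  have "(\<Sum>i<n. (A i i)\<^sup>2) = (\<Sum>i<n. (u i)\<^sup>2 + (u i * v i) * (2 / m) + (v i)\<^sup>2 / m\<^sup>2)"
    using m by (intro sum.cong refl) (simp add: diag power2_eq_square field_simps)
  also have "\<dots> = uu + uv * (2 / m) + vv / m\<^sup>2"
    unfolding sum.distrib sum_divide_distrib[symmetric] sum_distrib_right[symmetric]
    by (simp add: uu_def uv_def vv_def)
  finally show "(\<Sum>i<n. (A i i)\<^sup>2) = uu + 2 * uv / real n + vv / (real n)\<^sup>2"
    by (simp add: m_def)
  have "(\<Sum>i<n. \<Sum>j<n. (A i j)\<^sup>2)
     = (\<Sum>i<n. (u i)\<^sup>2 + (u i * v i) * (2 / m) + m * ((v i)\<^sup>2 / (4 * m\<^sup>2)) + v i * (V / (2 * m\<^sup>2)) + vv / (4 * m\<^sup>2)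
         + (\<Sum>j<n. (B i j)\<^sup>2) + (\<Sum>j<n. B i j * v j) / m)"
  proof (intro sum.cong refl)
    fix i assume "i \<in> {..<n}"
    then have i: "i < n" by simp
    \<comment> \<open>Of the products with \<open>B\<close>, the one with \<open>u i\<close> meets
      only the zero diagonal and the one with \<open>v i\<close> a zero row sum; the one with
      \<open>v j\<close> survives until \<open>i\<close> is summed as well.\<close>
    have "(\<Sum>j<n. (A i j)\<^sup>2) = (\<Sum>j<n. ((u i)\<^sup>2 + u i * (v i + v j) / m + 2 * u i * B i j) * of_bool (i = j)
        + (v i)\<^sup>2 / (4 * m\<^sup>2) + v j * (v i / (2 * m\<^sup>2)) + (v j)\<^sup>2 / (4 * m\<^sup>2) + (B i j)\<^sup>2 + B i j * (v i / m) + B i j * v j / m)"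
      using m by (intro sum.cong refl) (simp add: A power2_eq_square m_def[symmetric] field_simps)
    also have "\<dots> = (u i)\<^sup>2 + u i * (v i + v i) / m + m * ((v i)\<^sup>2 / (4 * m\<^sup>2)) + V * (v i / (2 * m\<^sup>2))
        + vv / (4 * m\<^sup>2) + (\<Sum>j<n. (B i j)\<^sup>2) + (\<Sum>j<n. B i j * v j) / m"
      unfolding sum.distrib sum_divide_distrib[symmetric] sum_distrib_right[symmetric] sum_times_of_bool_eq(1)[OF i] B(3)[rule_format, OF i]
      by (simp add: B(2) V_def vv_def m_def)
    finally show "(\<Sum>j<n. (A i j)\<^sup>2) = (u i)\<^sup>2 + (u i * v i) * (2 / m) + m * ((v i)\<^sup>2 / (4 * m\<^sup>2)) + v i * (V / (2 * m\<^sup>2))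
        + vv / (4 * m\<^sup>2) + (\<Sum>j<n. (B i j)\<^sup>2) + (\<Sum>j<n. B i j * v j) / m"
      by (simp add: mult_ac)
  qed
  also have "\<dots> = uu + uv * (2 / m) + m * (vv / (4 * m\<^sup>2)) + V * (V / (2 * m\<^sup>2)) + m * (vv / (4 * m\<^sup>2))
      + (\<Sum>i<n. \<Sum>j<n. (B i j)\<^sup>2) + (\<Sum>i<n. \<Sum>j<n. B i j * v j) / m"
    unfolding sum.distrib sum_divide_distrib[symmetric] sum_distrib_right[symmetric] sum_distrib_left[symmetric]
    by (simp add: uu_def uv_def vv_def V_def m_def)
  \<comment> \<open>By symmetry the column sums of \<open>B\<close> vanish too.\<close>
  also have "(\<Sum>i<n. \<Sum>j<n. B i j * v j) = 0"
  proof -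
    have "(\<Sum>i<n. \<Sum>j<n. B i j * v j) = (\<Sum>j<n. (\<Sum>i<n. B j i) * v j)"
      by (subst sum.swap) (simp add: sum_distrib_right B(1))
    then show ?thesis by (simp add: B(3))
  qed
  finally show "(\<Sum>i<n. \<Sum>j<n. (A i j)\<^sup>2)
      = uu + 2 * uv / real n + vv / (2 * real n) + V\<^sup>2 / (2 * (real n)\<^sup>2) + (\<Sum>i<n. \<Sum>j<n. (B i j)\<^sup>2)"
    using m unfolding m_def[symmetric] by (simp add: power2_eq_square)
qed

section \<open>The convex cone of the claimed forms\<close>

lemma psd2_add:
  assumes "psd2 a b c" "psd2 a' b' c'"
  shows "psd2 (a + a') (b + b') (c + c')"
  unfolding psd2_def
proof (intro allI)
  fix u v
  have "0 \<le> a * u\<^sup>2 + 2 * b * u * v + c * v\<^sup>2" "0 \<le> a' * u\<^sup>2 + 2 * b' * u * v + c' * v\<^sup>2"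
    using assms by (simp_all add: psd2_def)
  then show "0 \<le> (a + a') * u\<^sup>2 + 2 * (b + b') * u * v + (c + c') * v\<^sup>2"
    by (simp add: algebra_simps)
qed

text \<open>The matrix is \<open>k\<close> times the Gram matrix of the two vectors with their means
  subtracted, so its quadratic form is \<open>k\<close> times the squared norm of a centred
  combination.\<close>

lemma psd2_gram_centred:
  fixes a b :: "nat \<Rightarrow> real"
  assumes "n > 0" "k \<ge> 0"
  shows "psd2 (k * ((\<Sum>i<n. (a i)\<^sup>2) - (\<Sum>i<n. a i)\<^sup>2 / real n)) (k * ((\<Sum>i<n. b i * a i) - (\<Sum>i<n. b i) * (\<Sum>i<n. a i) / real n))
    (k * ((\<Sum>i<n. (b i)\<^sup>2) - (\<Sum>i<n. b i)\<^sup>2 / real n))"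
  unfolding psd2_def
proof (intro allI)
  fix s t
  define c where "c i = a i * s + b i * t" for i
  define M where "M = (\<Sum>i<n. c i) / real n"
  have "0 \<le> k * (\<Sum>i<n. (c i - M)\<^sup>2)" using assms by (intro mult_nonneg_nonneg sum_nonneg) auto
  also have "(\<Sum>i<n. (c i - M)\<^sup>2) = (\<Sum>i<n. (c i)\<^sup>2) - (\<Sum>i<n. c i)\<^sup>2 / real n"
  proof -
    have "(\<Sum>i<n. (c i - M)\<^sup>2) = (\<Sum>i<n. (c i)\<^sup>2) - (\<Sum>i<n. c i) * (2 * M) + n * M\<^sup>2"
      by (simp add: power2_diff sum.distrib sum_subtractf sum_distrib_left sum_distrib_right mult_ac)
    then show ?thesis using assms by (simp add: M_def power2_eq_square field_simps)
  qed
  also have "(\<Sum>i<n. c i) = (\<Sum>i<n. a i) * s + (\<Sum>i<n. b i) * t"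
    by (simp add: c_def sum.distrib sum_distrib_right)
  also have "(\<Sum>i<n. (c i)\<^sup>2) = (\<Sum>i<n. (a i)\<^sup>2) * s\<^sup>2 + (\<Sum>i<n. b i * a i) * (2 * s * t) + (\<Sum>i<n. (b i)\<^sup>2) * t\<^sup>2"
    unfolding sum_distrib_right sum.distrib[symmetric]
    by (intro sum.cong refl) (simp add: c_def power2_eq_square algebra_simps)
  finally show "0 \<le> k * ((\<Sum>i<n. (a i)\<^sup>2) - (\<Sum>i<n. a i)\<^sup>2 / real n) * s\<^sup>2
      + 2 * (k * ((\<Sum>i<n. b i * a i) - (\<Sum>i<n. b i) * (\<Sum>i<n. a i) / real n)) * s * t
      + k * ((\<Sum>i<n. (b i)\<^sup>2) - (\<Sum>i<n. b i)\<^sup>2 / real n) * t\<^sup>2"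
    using assms by (simp add: power2_eq_square algebra_simps add_divide_distrib)
qed

text \<open>The conclusion of the theorem as a predicate on \<open>f\<close>, so that closure under
  addition can be stated and the theorem follows by unfolding.\<close>

definition sos_cone :: "nat \<Rightarrow> ((nat \<Rightarrow> real) \<Rightarrow> real) \<Rightarrow> bool" where
  "sos_cone n f \<longleftrightarrow> (\<exists>a11 a12 a22 b11 b12 b22 \<gamma> :: real.
    \<gamma> \<ge> 0 \<and> psd2 a11 a12 a22 \<and> psd2 b11 b12 b22 \<and>
    (\<forall>x. let p1 = psum n 1 x; p2 = psum n 2 x; p3 = psum n 3 x; p4 = psum n 4 x in
      f x = a11 * p1^4 + 2 * a12 * (p2 * p1^2) + a22 * p2^2
          + b11 * (p2 * p1^2 - p1^4) + 2 * b12 * (p3 * p1 - p2 * p1^2) + b22 * (p4 - p2^2)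
          + \<gamma> * (1/2 * p1^4 - p2 * p1^2 + (real n ^ 2 - 3 * real n + 3) / (2 * real n ^ 2) * p2^2
                 + (2 * real n - 2) / real n ^ 2 * (p3 * p1) + (1 - real n) / (2 * real n ^ 2) * p4)))"

lemma sos_cone_zero: "sos_cone n (\<lambda>x. 0)"
  unfolding sos_cone_def by (intro exI[of _ 0]) (simp add: psd2_def)

lemma sos_cone_add:
  assumes "sos_cone n f" "sos_cone n g"
  shows "sos_cone n (\<lambda>x. f x + g x)"
proof -
  from assms(1) obtain a b c d e h k where 1: "k \<ge> 0" "psd2 a b c" "psd2 d e h"
    "\<forall>x. let p1 = psum n 1 x; p2 = psum n 2 x; p3 = psum n 3 x; p4 = psum n 4 x in
      f x = a * p1^4 + 2 * b * (p2 * p1^2) + c * p2^2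
          + d * (p2 * p1^2 - p1^4) + 2 * e * (p3 * p1 - p2 * p1^2) + h * (p4 - p2^2)
          + k * (1/2 * p1^4 - p2 * p1^2 + (real n ^ 2 - 3 * real n + 3) / (2 * real n ^ 2) * p2^2
                 + (2 * real n - 2) / real n ^ 2 * (p3 * p1) + (1 - real n) / (2 * real n ^ 2) * p4)"
    unfolding sos_cone_def by blast
  from assms(2) obtain a' b' c' d' e' h' k' where 2: "k' \<ge> 0" "psd2 a' b' c'" "psd2 d' e' h'"
    "\<forall>x. let p1 = psum n 1 x; p2 = psum n 2 x; p3 = psum n 3 x; p4 = psum n 4 x in
      g x = a' * p1^4 + 2 * b' * (p2 * p1^2) + c' * p2^2
          + d' * (p2 * p1^2 - p1^4) + 2 * e' * (p3 * p1 - p2 * p1^2) + h' * (p4 - p2^2)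
          + k' * (1/2 * p1^4 - p2 * p1^2 + (real n ^ 2 - 3 * real n + 3) / (2 * real n ^ 2) * p2^2
                 + (2 * real n - 2) / real n ^ 2 * (p3 * p1) + (1 - real n) / (2 * real n ^ 2) * p4)"
    unfolding sos_cone_def by blast
  \<comment> \<open>The seven basis forms are abstracted to variables, which leaves an identity
    linear in the coefficients.\<close>
  have lin: "(a + a') * A + 2 * (b + b') * B + (c + c') * C + (d + d') * D + 2 * (e + e') * E + (h + h') * H + (k + k') * G
      = (a * A + 2 * b * B + c * C + d * D + 2 * e * E + h * H + k * G)
        + (a' * A + 2 * b' * B + c' * C + d' * D + 2 * e' * E + h' * H + k' * G)" for A B C D E H G
    by (simp add: algebra_simps)
  show ?thesis unfolding sos_cone_def
  proof (rule exI[of _ "a + a'"], rule exI[of _ "b + b'"], rule exI[of _ "c + c'"], rule exI[of _ "d + d'"],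
      rule exI[of _ "e + e'"], rule exI[of _ "h + h'"], rule exI[of _ "k + k'"], intro conjI allI)
    show "0 \<le> k + k'" using 1(1) 2(1) by simp
    show "psd2 (a + a') (b + b') (c + c')" "psd2 (d + d') (e + e') (h + h')"
      using 1(2,3) 2(2,3) by (simp_all add: psd2_add)
    fix x
    show "let p1 = psum n 1 x; p2 = psum n 2 x; p3 = psum n 3 x; p4 = psum n 4 x in
      f x + g x = (a + a') * p1^4 + 2 * (b + b') * (p2 * p1^2) + (c + c') * p2^2
          + (d + d') * (p2 * p1^2 - p1^4) + 2 * (e + e') * (p3 * p1 - p2 * p1^2) + (h + h') * (p4 - p2^2)
          + (k + k') * (1/2 * p1^4 - p2 * p1^2 + (real n ^ 2 - 3 * real n + 3) / (2 * real n ^ 2) * p2^2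
                 + (2 * real n - 2) / real n ^ 2 * (p3 * p1) + (1 - real n) / (2 * real n ^ 2) * p4)"
      using 1(4)[rule_format, of x] 2(4)[rule_format, of x] unfolding Let_def lin
      by (simp only:)
  qed
qed

section \<open>The average of the square of one quadratic form\<close>

text \<open>The first row of each matrix belongs to \<open>v\<close> and the second to
  \<open>u\<close>: \<open>\<alpha>\<close> is the rank one matrix of the vector
  \<open>(V, U)\<close>, \<open>\<beta>\<close> is \<open>\<kappa>\<close> times the centred Gram
  matrix, and \<open>\<gamma>\<close> is \<open>K * bb\<close>.\<close>

lemma sos_cone_square_average:
  assumes n: "n \<ge> 4" and g: "quad_form n g"
  shows "sos_cone n (\<lambda>x. perm_avg n (\<lambda>\<sigma>. (g (x \<circ> \<sigma>))\<^sup>2))"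
proof -
  obtain A where sym: "\<And>i j. A i j = A j i" and gA: "\<And>x. g x = (\<Sum>i<n. \<Sum>j<n. A i j * (x i * x j))"
    using quad_form_symmetric_matrix[OF g] by blast
  have n3: "n \<ge> 3" using n by simp
  obtain u v B where A: "\<And>i j. A i j = of_bool (i = j) * u i + (v i + v j) / (2 * real n) + B i j"
    and B: "\<And>i j. B i j = B j i" "\<And>i. B i i = 0" "\<forall>i<n. (\<Sum>j<n. B i j) = 0"
    by (rule symmetric_matrix_decomposition[of n A, OF n3 sym]) (rule that)
  define U V uu uv vv bb where "U = (\<Sum>i<n. u i)" and "V = (\<Sum>i<n. v i)"
    and "uu = (\<Sum>i<n. (u i)\<^sup>2)" and "uv = (\<Sum>i<n. u i * v i)" and "vv = (\<Sum>i<n. (v i)\<^sup>2)"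
    and "bb = (\<Sum>i<n. \<Sum>j<n. (B i j)\<^sup>2)"
  have n0: "n > 0" using n by simp
  note sums = decomposed_matrix_sums[where A = A and B = B, OF n0 A B, folded U_def V_def uu_def uv_def vv_def bb_def]
  \<comment> \<open>Both constants come from \<open>moment_coefficient_identities\<close>:
    \<open>K\<close> from its last identity, and \<open>\<kappa>\<close> from the coefficients of
    \<open>uu\<close>, \<open>uv\<close> and \<open>vv\<close>.\<close>
  define K where "K = 4 * real n ^ 3 / ((real n - 1) * (real n - 2) * (real n - 3))"
  define \<kappa> where "\<kappa> = real n / (real n - 1)"
  have \<kappa>: "\<kappa> / real n = 1 / (real n - 1)" "\<kappa> \<ge> 0" using n by (simp_all add: \<kappa>_def)
  have "K * bb \<ge> 0" unfolding K_def bb_def using n by (intro mult_nonneg_nonneg sum_nonneg divide_nonneg_nonneg) auto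
  moreover have "psd2 (V\<^sup>2) (U * V) (U\<^sup>2)"
    unfolding psd2_def
  proof (intro allI)
    fix s t
    have "0 \<le> (V * s + U * t)\<^sup>2" by simp
    then show "0 \<le> V\<^sup>2 * s\<^sup>2 + 2 * (U * V) * s * t + U\<^sup>2 * t\<^sup>2" by (simp add: power2_eq_square algebra_simps)
  qed
  moreover have "psd2 (\<kappa> * (vv - V\<^sup>2 / real n)) (\<kappa> * (uv - U * V / real n)) (\<kappa> * (uu - U\<^sup>2 / real n))"
    unfolding vv_def uv_def uu_def U_def V_def using n0 \<kappa> by (intro psd2_gram_centred)
  moreover have "perm_avg n (\<lambda>\<sigma>. (g (x \<circ> \<sigma>))\<^sup>2) = V\<^sup>2 * p1^4 + 2 * (U * V) * (p2 * p1^2) + U\<^sup>2 * p2^2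
          + \<kappa> * (vv - V\<^sup>2 / real n) * (p2 * p1^2 - p1^4) + 2 * (\<kappa> * (uv - U * V / real n)) * (p3 * p1 - p2 * p1^2)
          + \<kappa> * (uu - U\<^sup>2 / real n) * (p4 - p2^2)
          + K * bb * (1/2 * p1^4 - p2 * p1^2 + (real n ^ 2 - 3 * real n + 3) / (2 * real n ^ 2) * p2^2
                 + (2 * real n - 2) / real n ^ 2 * (p3 * p1) + (1 - real n) / (2 * real n ^ 2) * p4)"
    if p: "p1 = psum n 1 x" "p2 = psum n 2 x" "p3 = psum n 3 x" "p4 = psum n 4 x" for x p1 p2 p3 p4
  proof -
    have "(g (x \<circ> \<sigma>))\<^sup>2 = (\<Sum>i<n. \<Sum>j<n. \<Sum>k<n. \<Sum>l<n. A i j * A k l * (x (\<sigma> i) * x (\<sigma> j) * x (\<sigma> k) * x (\<sigma> l)))" for \<sigma>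
    proof -
      have G: "g (x \<circ> \<sigma>) = (\<Sum>i<n. \<Sum>j<n. A i j * (x (\<sigma> i) * x (\<sigma> j)))" by (simp add: gA)
      have "(g (x \<circ> \<sigma>))\<^sup>2 = (\<Sum>i<n. \<Sum>j<n. A i j * (x (\<sigma> i) * x (\<sigma> j)) * g (x \<circ> \<sigma>))"
        unfolding sum_distrib_right[symmetric] G power2_eq_square ..
      then show ?thesis unfolding G sum_distrib_left by (simp only: mult_ac)
    qed
    then have "perm_avg n (\<lambda>\<sigma>. (g (x \<circ> \<sigma>))\<^sup>2) = (\<Sum>i<n. \<Sum>j<n. \<Sum>k<n. \<Sum>l<n. A i j * A k l *
        perm_avg n (\<lambda>\<sigma>. x (\<sigma> i) * x (\<sigma> j) * x (\<sigma> k) * x (\<sigma> l)))"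
      by (simp add: perm_avg_sum perm_avg_cmult)
    note sum_expand = this
    let ?t31 = "avg31 n x" and ?t22 = "avg22 n x" and ?t211 = "avg211 n x" and ?t1111 = "avg1111 n x"
    let ?c1 = "?t211 - ?t1111" and ?c2 = "?t22 - 2 * ?t211 + ?t1111" and ?c3 = "?t31 - 3 * ?t211 + 2 * ?t1111"
      and ?c4 = "p4 - 4 * ?t31 - 3 * ?t22 + 12 * ?t211 - 6 * ?t1111"
    have "perm_avg n (\<lambda>\<sigma>. (g (x \<circ> \<sigma>))\<^sup>2) = ?t1111 * (U + V)\<^sup>2
      + ?c1 * (2 * (U + V / real n) * (U + V) + 4 * (uu + uv + vv / 4 + U * V / real n + 3 * V\<^sup>2 / (4 * real n)))
      + ?c2 * ((U + V / real n)\<^sup>2 + 2 * (uu + 2 * uv / real n + vv / (2 * real n) + V\<^sup>2 / (2 * (real n)\<^sup>2) + bb))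
      + ?c3 * (4 * (uu + uv * (1 / 2 + 1 / real n) + vv / (2 * real n) + U * V / (2 * real n) + V\<^sup>2 / (2 * (real n)\<^sup>2)))
      + ?c4 * (uu + 2 * uv / real n + vv / (real n)\<^sup>2)"
      unfolding sum_expand p
      by (rule trans[OF _ quartic_contraction[where A = A and n = n, OF sym, unfolded sums]], intro sum.cong refl)
        (simp add: perm_avg_quartic[OF n])
    also have "\<dots> = U\<^sup>2 * ?t22
      + U * V * (2 * ?t1111 + 2 * ?c1 * (1 + 3 / real n) + 2 * ?c2 / real n + 2 * ?c3 / real n)
      + V\<^sup>2 * (?t1111 + 5 * ?c1 / real n + 2 * ?c2 / (real n)\<^sup>2 + 2 * ?c3 / (real n)\<^sup>2)
      + uu * (p4 - ?t22)
      + uv * (4 * ?c1 + 4 * ?c2 / real n + 4 * ?c3 * (1 / 2 + 1 / real n) + 2 * ?c4 / real n)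
      + vv * (?c1 + ?c2 / real n + 2 * ?c3 / real n + ?c4 / (real n)\<^sup>2)
      + bb * (2 * ?c2)"
    proof -
      \<comment> \<open>With \<open>q\<close> for the reciprocal of \<open>n\<close>, the regrouping
        is a polynomial identity.\<close>
      define q where "q = 1 / real n"
      have q: "a / real n = a * q" "a / (2 * real n) = a * q / 2" "a / (4 * real n) = a * q / 4"
        "a / (real n)\<^sup>2 = a * q\<^sup>2" "a / (2 * (real n)\<^sup>2) = a * q\<^sup>2 / 2" for a
        by (simp_all add: q_def power2_eq_square)
      show ?thesis unfolding q by (simp add: algebra_simps power2_eq_square)
    qed
    \<comment> \<open>The corrections with factor \<open>\<kappa> / real n\<close> subtract the
      means: in the next step they turn \<open>uu\<close>, \<open>uv\<close> and \<open>vv\<close>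
      into centred Gram entries.\<close>
    also have "\<dots> = U\<^sup>2 * (p2\<^sup>2 - \<kappa> / real n * (p4 - p2\<^sup>2))
      + U * V * (2 * p2 * p1\<^sup>2 - 2 * (\<kappa> / real n) * (p3 * p1 - p2 * p1\<^sup>2))
      + V\<^sup>2 * (p1 ^ 4 - \<kappa> / real n * (p2 * p1\<^sup>2 - p1 ^ 4))
      + uu * (\<kappa> * (p4 - p2\<^sup>2)) + uv * (2 * \<kappa> * (p3 * p1 - p2 * p1\<^sup>2)) + vv * (\<kappa> * (p2 * p1\<^sup>2 - p1 ^ 4))
      + bb * (K * (1/2 * p1^4 - p2 * p1^2 + (real n ^ 2 - 3 * real n + 3) / (2 * real n ^ 2) * p2^2
                 + (2 * real n - 2) / real n ^ 2 * (p3 * p1) + (1 - real n) / (2 * real n ^ 2) * p4))"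
    proof -
      have "3 < real n" using n by simp
      note ids = moment_coefficient_identities(1,4)[where ?p2.0 = p2 and ?p4.0 = p4, OF this, unfolded p]
        moment_coefficient_identities(2,3,5-7)[where ?p1.0 = p1 and ?p2.0 = p2 and ?p3.0 = p3 and ?p4.0 = p4, OF this, unfolded p]
      note ids = ids[folded avg31_def avg22_def avg21_def avg11_def, folded avg211_def avg111_def, folded avg1111_def]
      have two: "2 * (1 / (real n - 1)) = 2 / (real n - 1)" by simp
      \<comment> \<open>\<open>ids(2)\<close> is used from right to left, as \<open>avg22\<close>
        also occurs inside the other coefficients.\<close>
      show ?thesis unfolding p \<kappa> two unfolding \<kappa>_def K_def ids(1,3-6) ids(2)[symmetric]
        by (simp only: ids(7))
    qed
    also have "\<dots> = V\<^sup>2 * p1^4 + 2 * (U * V) * (p2 * p1^2) + U\<^sup>2 * p2^2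
          + \<kappa> * (vv - V\<^sup>2 / real n) * (p2 * p1^2 - p1^4) + 2 * (\<kappa> * (uv - U * V / real n)) * (p3 * p1 - p2 * p1^2)
          + \<kappa> * (uu - U\<^sup>2 / real n) * (p4 - p2^2)
          + K * bb * (1/2 * p1^4 - p2 * p1^2 + (real n ^ 2 - 3 * real n + 3) / (2 * real n ^ 2) * p2^2
                 + (2 * real n - 2) / real n ^ 2 * (p3 * p1) + (1 - real n) / (2 * real n ^ 2) * p4)"
      (is "?L + bb * (K * ?G) = ?R + K * bb * ?G")
    proof -
      have "?L = ?R" by (simp add: algebra_simps diff_divide_distrib)
      then show ?thesis by simp
    qed
    finally show ?thesis .
  qed
  ultimately show ?thesis unfolding sos_cone_def Let_def by blast
qed

theorem theorem6p1:
  fixes n :: nat and f :: "(nat \<Rightarrow> real) \<Rightarrow> real"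
  assumes "n \<ge> 4" and "form_deg n 4 f" and "symmetric_poly n f" and "sos n f"
  shows "\<exists>a11 a12 a22 b11 b12 b22 \<gamma> :: real.
    \<gamma> \<ge> 0 \<and> psd2 a11 a12 a22 \<and> psd2 b11 b12 b22 \<and>
    (\<forall>x. let p1 = psum n 1 x; p2 = psum n 2 x; p3 = psum n 3 x; p4 = psum n 4 x in
      f x = a11 * p1^4 + 2 * a12 * (p2 * p1^2) + a22 * p2^2
          + b11 * (p2 * p1^2 - p1^4) + 2 * b12 * (p3 * p1 - p2 * p1^2) + b22 * (p4 - p2^2)
          + \<gamma> * (1/2 * p1^4 - p2 * p1^2 + (real n ^ 2 - 3 * real n + 3) / (2 * real n ^ 2) * p2^2
                 + (2 * real n - 2) / real n ^ 2 * (p3 * p1) + (1 - real n) / (2 * real n ^ 2) * p4))"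
proof -
  obtain gs where gs: "\<forall>g\<in>set gs. poly_fun n g" and f: "\<And>x. f x = (\<Sum>g\<leftarrow>gs. (g x)\<^sup>2)"
    using assms(4) unfolding sos_def by blast
  have quad: "\<forall>g\<in>set gs. quad_form n g"
    using sos_quartic_quad_forms[OF assms(2) f] gs by blast
  \<comment> \<open>The induction runs over averages: the single squares need not be symmetric, but
    their averages are.\<close>
  have "sos_cone n (\<lambda>x. perm_avg n (\<lambda>\<sigma>. \<Sum>g\<leftarrow>gs. (g (x \<circ> \<sigma>))\<^sup>2))"
    using quad
  proof (induction gs)
    case Nil
    then show ?case by (simp add: perm_avg_const sos_cone_zero)
  next
    case (Cons g gs)
    from Cons.prems have "quad_form n g" "\<forall>g\<in>set gs. quad_form n g" by simp_all
    from sos_cone_add[OF sos_cone_square_average[OF assms(1) this(1)] Cons.IH[OF this(2)]]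
    show ?case by (simp only: list.map sum_list.Cons perm_avg_add)
  qed
  moreover have "perm_avg n (\<lambda>\<sigma>. \<Sum>g\<leftarrow>gs. (g (x \<circ> \<sigma>))\<^sup>2) = f x" for x
  proof -
    have "perm_avg n (\<lambda>\<sigma>. \<Sum>g\<leftarrow>gs. (g (x \<circ> \<sigma>))\<^sup>2) = perm_avg n (\<lambda>_. f x)"
      using assms(3) unfolding symmetric_poly_def f[symmetric] by (intro perm_avg_cong) blast
    then show ?thesis by (simp add: perm_avg_const)
  qed
  ultimately have "sos_cone n f" by simp
  then show ?thesis unfolding sos_cone_def .
qed
end
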